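(* Let $\mu$ be a positive (Laplace-transformable) Radon measure on $\mathbb R_+$ such that $f=\mathcal L\mu$ is a potential with $f(0+)=\infty$. Let $-A$ generate a bounded $C_0$-semigroup $(T(s))_{s\ge0}$ on a Banach space $X$, and let $x,y\in X$ satisfy \[\lim_{\alpha\searrow0}\int_0^\infty e^{-\alpha s}T(s)x\,\mu(\mathrm ds)=y\quad\text{weakly}.\] Then: (a) $x=(1/f)(A)y$ and $\|\mathcal C_t(A)x\|=O\big(1/f(1/t)\big)$ as $t\to\infty$; (b) if moreover $t/f(1/t)\to\infty$ as $t\to\infty$, then $\|\mathcal C_t(A)x\|=o\big(1/f(1/t)\big)$ as $t\to\infty$.
   Context: $\mathcal L\mu(z)=\int_{\mathbb R_+}e^{-sz}\mu(\mathrm ds)$. A Bernstein function is $g(z)=a+bz+\int_{(0,\infty)}(1-e^{-sz})\nu(\mathrm ds)$ with $a,b\ge0$, $\nu$ positive Radon on $(0,\infty)$, $\int\frac{s}{1+s}\nu(\mathrm ds)<\infty$. A potential is a completely monotone function $f$ (i.e. $C^\infty$ on $(0,\infty)$ with $(-1)^nf^{(n)}\ge0$ for all $n\ge0$) of the form $f=1/g$ with $g\ne0$ a Bernstein function; $(1/f)(A)=g(A)$ is defined via the extended Hille–Phillips calculus (for $\hat\nu\in\mathcal W^+$, i.e. Laplace transforms of bounded complex measures, $\hat\nu(A)x=\int T(s)x\,\nu(\mathrm ds)$; for holomorphic $h$ on $\{\operatorname{Re}z>0\}$, $h(A):=e(A)^{-1}(eh)(A)$ on $\{x:(eh)(A)x\in\operatorname{ran}e(A)\}$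 where $e,eh\in\mathcal W^+$ and $e(A)$ injective). Cesàro means: $\mathcal C_t(A)x=\frac1t\int_0^tT(s)x\,\mathrm ds$. *)

theory Defs
  imports "HOL-Analysis.Analysis" "HOL-Library.Landau_Symbols"
begin

text \<open>T s is the semigroup operator T(s); its generator is -A. All objects
 depending on A are expressed through T.\<close>

definition bounded_C0_semigroup :: "(real \<Rightarrow> 'a::banach \<Rightarrow> 'a) \<Rightarrow> bool" where
  "bounded_C0_semigroup T \<longleftrightarrow>
     (\<forall>s\<ge>0. bounded_linear (T s)) \<and>
     T 0 = id \<and>
     (\<forall>s t. s \<ge> 0 \<longrightarrow> t \<ge> 0 \<longrightarrow> T (s + t) = T s \<circ> T t) \<and>
     (\<forall>x. ((\<lambda>s. T s x) \<longlongrightarrow> x) (at_right 0)) \<and>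
     (\<exists>M. \<forall>s\<ge>0. onorm (T s) \<le> M)"

definition cesaro :: "(real \<Rightarrow> 'a::banach \<Rightarrow> 'a) \<Rightarrow> real \<Rightarrow> 'a \<Rightarrow> 'a" where
  "cesaro T t x = (1 / t) *\<^sub>R integral {0..t} (\<lambda>s. T s x)"

definition radon_Rplus :: "real measure \<Rightarrow> bool" where
  "radon_Rplus \<mu> \<longleftrightarrow> sets \<mu> = sets borel \<and> emeasure \<mu> {..<0} = 0 \<and>
     (\<forall>K. compact K \<longrightarrow> emeasure \<mu> K < \<infinity>)"

definition laplace_transformable :: "real measure \<Rightarrow> bool" where
  "laplace_transformable \<mu> \<longleftrightarrow> (\<forall>z>0. set_integrable \<mu> {0..} (\<lambda>s. exp (- s * z)))"

definition laplace :: "real measure \<Rightarrow> real \<Rightarrow> real" where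
  "laplace \<mu> z = (LINT s:{0..}|\<mu>. exp (- s * z))"

definition bernstein :: "(real \<Rightarrow> real) \<Rightarrow> bool" where
  "bernstein g \<longleftrightarrow> (\<exists>a b \<nu>. a \<ge> 0 \<and> b \<ge> 0 \<and>
     sets \<nu> = sets borel \<and> emeasure \<nu> {..0} = 0 \<and>
     (\<forall>K. compact K \<longrightarrow> K \<subseteq> {0<..} \<longrightarrow> emeasure \<nu> K < \<infinity>) \<and>
     set_integrable \<nu> {0<..} (\<lambda>s. s / (1 + s)) \<and>
     (\<forall>z>0. g z = a + b * z + (LINT s:{0<..}|\<nu>. 1 - exp (- s * z))))"

definition completely_monotone :: "(real \<Rightarrow> real) \<Rightarrow> bool" where
  "completely_monotone f \<longleftrightarrow>
     (\<forall>n z. z > 0 \<longrightarrow> ((deriv ^^ n) f has_real_derivative (deriv ^^ Suc n) f z) (at z)) \<and>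
     (\<forall>n z. z > 0 \<longrightarrow> (-1) ^ n * (deriv ^^ n) f z \<ge> 0)"

definition potential :: "(real \<Rightarrow> real) \<Rightarrow> bool" where
  "potential f \<longleftrightarrow> completely_monotone f \<and>
     (\<exists>g. bernstein g \<and> (\<exists>z>0. g z \<noteq> 0) \<and> (\<forall>z>0. f z = 1 / g z))"

text \<open>A bounded (real, signed) measure on R_+ is represented as a difference
 \<nu>1 - \<nu>2 of finite positive Borel measures carried by [0,\<infinity>).\<close>
definition finite_Rplus :: "real measure \<Rightarrow> bool" where
  "finite_Rplus \<nu> \<longleftrightarrow> sets \<nu> = sets borel \<and> finite_measure \<nu> \<and> emeasure \<nu> {..<0} = 0"

definition laplace2 :: "real measure \<Rightarrow> real measure \<Rightarrow> real \<Rightarrow> real" where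
  "laplace2 \<nu>1 \<nu>2 z = laplace \<nu>1 z - laplace \<nu>2 z"

text \<open>hp_apply \<nu>1 \<nu>2 T x w  means  w = \<nu>^(A) x = \<integral> T(s) x (\<nu>1 - \<nu>2)(ds),
 the vector integral being characterised through all bounded linear functionals.\<close>
definition hp_apply :: "real measure \<Rightarrow> real measure \<Rightarrow> (real \<Rightarrow> 'a::banach \<Rightarrow> 'a) \<Rightarrow> 'a \<Rightarrow> 'a \<Rightarrow> bool" where
  "hp_apply \<nu>1 \<nu>2 T x w \<longleftrightarrow>
     (\<forall>\<phi>::'a \<Rightarrow> real. bounded_linear \<phi> \<longrightarrow>
        \<phi> w = (LINT s:{0..}|\<nu>1. \<phi> (T s x)) - (LINT s:{0..}|\<nu>2. \<phi> (T s x)))"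

text \<open>Extended Hille--Phillips calculus: hp_ext h T y x  means  x = h(A) y, i.e.
 for a regulariser e \<in> W+ with e(A) injective and e h \<in> W+, we have
 (e h)(A) y = e(A) x (equivalently y \<in> dom h(A) and h(A) y = e(A)^{-1} (e h)(A) y;
 this is independent of the regulariser).\<close>
definition hp_ext :: "(real \<Rightarrow> real) \<Rightarrow> (real \<Rightarrow> 'a::banach \<Rightarrow> 'a) \<Rightarrow> 'a \<Rightarrow> 'a \<Rightarrow> bool" where
  "hp_ext h T y x \<longleftrightarrow> (\<exists>e1 e2 k1 k2 w.
      finite_Rplus e1 \<and> finite_Rplus e2 \<and> finite_Rplus k1 \<and> finite_Rplus k2 \<and>
      (\<forall>z>0. laplace2 k1 k2 z = laplace2 e1 e2 z * h z) \<and>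
      (\<forall>u. hp_apply e1 e2 T u 0 \<longrightarrow> u = 0) \<and>
      hp_apply e1 e2 T x w \<and> hp_apply k1 k2 T y w)"

end

theory Submission
  imports Defs
begin

text \<open>
  Write \<open>f = 1 / g\<close>, where \<open>g z = b z + \<integral> (1 - exp (- s z)) \<nu>(ds)\<close>; there is no constant term because
  \<open>f(0+) = \<infinity>\<close>. Testing with functionals reduces everything to the scalar orbits
  \<open>F s = \<phi> (T s x)\<close> and \<open>G s = \<phi> (T s y)\<close>, where \<open>G\<close> is the Abel limit of the convolution of \<open>F\<close>
  with \<open>\<mu>\<close>. If two sequentially continuous functionals on bounded continuous functions satisfy
  \<open>f z * \<Gamma>(exp (- z \<sqdot>)) = \<Lambda>(exp (- z \<sqdot>))\<close> for all \<open>z > 0\<close>, then \<open>\<Lambda> F = \<Gamma> G\<close>, since exponentials are dense.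
  With \<open>\<Lambda> = \<integral> \<sqdot> u exp (- u) du\<close> this is the identity \<open>e(A) x = (e g)(A) y\<close> for the regulariser
  \<open>e z = 1 / (1 + z)\<^sup>2\<close>; with \<open>\<Lambda> = \<integral>\<^sub>0\<^sup>t\<close> the corresponding \<open>\<Gamma>\<close> has norm at most \<open>4 t g(1 / t)\<close>, which
  gives the \<open>O\<close>-estimate. On elements \<open>w - T r w\<close> the roles of \<open>r\<close> and \<open>t\<close> can be exchanged, so there
  the estimate is \<open>O(1 / t)\<close>, and by Hahn-Banach \<open>y\<close> lies in their closed span.
\<close>

subsection \<open>Hahn-Banach theorem and uniform boundedness\<close>

text \<open>The obstacle is that \<open>F\<close> is merely bounded, so its convolution with \<mu>
  need not converge, and the weak limit controls the Abel means for one functional at a time.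
  Damping \<open>F\<close> by \<open>exp (- \<alpha> u)\<close> makes the convolution converge;
  removing the damping needs a bound that is uniform in \<alpha> and in all translates of the orbit.
  It is obtained by viewing the Abel means as functionals on the dual space, where the compositions
  of \<phi> with \<open>T r\<close> form a bounded family. The regulariser has a double pole because
  \<open>b z / (1 + z)\<close> is the transform of a measure with an atom at \<open>0\<close>,
  whereas \<open>b z / (1 + z)\<^sup>2\<close> comes from an integrable density. The constant
  \<open>4\<close> is a product of two factors \<open>2\<close>: one from a difference of two
  increments of a primitive, one from comparing \<open>min s t\<close> with
  \<open>t (1 - exp (- s / t))\<close>. The roles of \<open>r\<close> and \<open>t\<close> can be
  exchanged because the integral of \<open>T\<close> over \<open>[0, t]\<close> is formally the
  inverse of \<open>A\<close> applied to \<open>I - T t\<close>; multiplied by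
  \<open>I - T r\<close> it becomes symmetric in \<open>r\<close> and \<open>t\<close>.\<close>

definition sublinear :: "('a::real_vector \<Rightarrow> real) \<Rightarrow> bool" where
  "sublinear p \<longleftrightarrow> (\<forall>x y. p (x + y) \<le> p x + p y) \<and> (\<forall>c x. c \<ge> 0 \<longrightarrow> p (c *\<^sub>R x) = c * p x)"

lemma sublinear_add: "sublinear p \<Longrightarrow> p (x + y) \<le> p x + p y"
  and sublinear_scaleR: "sublinear p \<Longrightarrow> c \<ge> 0 \<Longrightarrow> p (c *\<^sub>R x) = c * p x"
  by (auto simp: sublinear_def)

lemma sublinear_zero: "sublinear p \<Longrightarrow> p 0 = 0"
  using sublinear_scaleR[of p 0 0] by simp

lemma sublinear_uminus_ge: "sublinear p \<Longrightarrow> - p (- x) \<le> p x"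
  using sublinear_add[of p x "- x"] sublinear_zero[of p] by simp

text \<open>The greatest sublinear functional below \<open>p\<close> whose value at \<open>- v\<close> is at most \<open>- p v\<close>.\<close>

definition sublinear_reduce :: "('a::real_vector \<Rightarrow> real) \<Rightarrow> 'a \<Rightarrow> 'a \<Rightarrow> real" where
  "sublinear_reduce p v x = (INF l\<in>{0..}. p (x + l *\<^sub>R v) - l * p v)"

lemma sublinear_reduce_bdd:
  assumes "sublinear p"
  shows "bdd_below ((\<lambda>l. p (x + l *\<^sub>R v) - l * p v) ` {0..})"
proof (rule bdd_belowI2)
  fix l :: real assume "l \<in> {0..}"
  then have "p (l *\<^sub>R v) = l * p v" using assms sublinear_scaleR by auto
  with sublinear_add[OF assms, of "x + l *\<^sub>R v" "- x"] show "- p (- x) \<le> p (x + l *\<^sub>R v) - l * p v"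
    by simp
qed

lemma sublinear_reduce_le:
  assumes "sublinear p" "l \<ge> 0"
  shows "sublinear_reduce p v x \<le> p (x + l *\<^sub>R v) - l * p v"
  unfolding sublinear_reduce_def
  by (rule cINF_lower[OF sublinear_reduce_bdd[OF assms(1)]]) (use assms in auto)

lemma sublinear_sublinear_reduce:
  assumes p: "sublinear p"
  shows "sublinear (sublinear_reduce p v)"
  unfolding sublinear_def
proof (intro conjI allI impI)
  fix x y
  \<comment> \<open>The parameters add up: \<open>k\<close> used for \<open>x\<close> and
    \<open>l\<close> used for \<open>y\<close> make \<open>k + l\<close> admissible for
    \<open>x + y\<close>. The two infima are then taken one after the other.\<close>
  have "sublinear_reduce p v (x + y) \<le> (p (x + k *\<^sub>R v) - k * p v) + (p (y + l *\<^sub>R v) - l * p v)"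
    if "k \<ge> 0" "l \<ge> 0" for k l
    using sublinear_reduce_le[OF p, of "k + l" v "x + y"] that
      sublinear_add[OF p, of "x + k *\<^sub>R v" "y + l *\<^sub>R v"]
    by (simp add: algebra_simps)
  then have "sublinear_reduce p v (x + y) - (p (x + k *\<^sub>R v) - k * p v) \<le> sublinear_reduce p v y"
    if "k \<ge> 0" for k
    unfolding sublinear_reduce_def[of p v y] using that
    by (intro cINF_greatest) (auto simp: diff_le_eq add.commute)
  then have "sublinear_reduce p v (x + y) - sublinear_reduce p v y \<le> sublinear_reduce p v x"
    unfolding sublinear_reduce_def[of p v x]
    by (intro cINF_greatest) (auto simp: algebra_simps)
  then show "sublinear_reduce p v (x + y) \<le> sublinear_reduce p v x + sublinear_reduce p v y"
    by simp
next
  fix c :: real and x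
  assume c: "c \<ge> 0"
  \<comment> \<open>Substituting \<open>d * l\<close> for \<open>l\<close> in the infimum gives one
    inequality for every \<open>d > 0\<close>; using it for \<open>c\<close> and for
    \<open>1 / c\<close> yields equality.\<close>
  have le: "sublinear_reduce p v (d *\<^sub>R x) \<le> d * sublinear_reduce p v x" if "d > 0" for d x
  proof -
    have "sublinear_reduce p v (d *\<^sub>R x) / d \<le> p (x + l *\<^sub>R v) - l * p v" if "l \<ge> 0" for l
    proof -
      have "p (d *\<^sub>R x + (d * l) *\<^sub>R v) = d * p (x + l *\<^sub>R v)"
        using sublinear_scaleR[OF p, of d "x + l *\<^sub>R v"] \<open>d > 0\<close> by (simp add: scaleR_add_right)
      then show ?thesis
        using sublinear_reduce_le[OF p, of "d * l" v "d *\<^sub>R x"] that \<open>d > 0\<close>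
        by (simp add: field_simps)
    qed
    then have "sublinear_reduce p v (d *\<^sub>R x) / d \<le> sublinear_reduce p v x"
      unfolding sublinear_reduce_def[of p v x] by (intro cINF_greatest) auto
    then show ?thesis using that by (simp add: field_simps)
  qed
  show "sublinear_reduce p v (c *\<^sub>R x) = c * sublinear_reduce p v x"
  proof (cases "c = 0")
    case True
    have "(\<lambda>l. p (0 + l *\<^sub>R v) - l * p v) ` {0..} = {0}"
      using sublinear_scaleR[OF p] by force
    then show ?thesis using True by (simp add: sublinear_reduce_def)
  next
    case False
    with c have "c > 0" by simp
    moreover have "sublinear_reduce p v x \<le> sublinear_reduce p v (c *\<^sub>R x) / c"
      using le[of "1 / c" "c *\<^sub>R x"] \<open>c > 0\<close> by simp
    ultimately show ?thesis using le[of c x] by (simp add: field_simps)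
  qed
qed

lemma sublinear_reduce_le_self: "sublinear p \<Longrightarrow> sublinear_reduce p v x \<le> p x"
  using sublinear_reduce_le[of p 0 v x] by simp

lemma sublinear_reduce_uminus: "sublinear p \<Longrightarrow> sublinear_reduce p v (- v) \<le> - p v"
  using sublinear_reduce_le[of p 1 v "- v"] by (simp add: sublinear_zero)

text \<open>A pointwise minimal sublinear functional coincides with all its reductions, hence is odd,
  hence linear.\<close>

theorem Hahn_Banach_sublinear:
  fixes p :: "'a::real_vector \<Rightarrow> real"
  assumes p: "sublinear p"
  obtains \<phi> where "linear \<phi>" "\<And>x. \<phi> x \<le> p x" "\<phi> v = p v"
proof -
  \<comment> \<open>Starting below \<open>sublinear_reduce p v\<close> instead of \<open>p\<close>
    forces the value at \<open>- v\<close> down to \<open>- p v\<close>; once the minimal functional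
    is known to be odd, it attains \<open>p v\<close> at \<open>v\<close>.\<close>
  define S where "S = {q. sublinear q \<and> q \<le> sublinear_reduce p v}"
  \<comment> \<open>The order is reversed, so that the maximal element delivered by Zorn's lemma is
    a minimal functional.\<close>
  define R where "R = (\<lambda>q r :: 'a \<Rightarrow> real. r \<le> q)"
  have po: "partial_order_on S (relation_of R S)"
    by (auto simp: partial_order_on_def preorder_on_def relation_of_def R_def refl_on_def
        trans_def antisym_def)
  have "\<exists>m\<in>S. \<forall>a\<in>S. R m a \<longrightarrow> a = m"
  proof (rule predicate_Zorn[OF po])
    fix C assume C: "C \<in> Chains (relation_of R S)"
    have CS: "C \<subseteq> S" and tot: "\<And>q r. q \<in> C \<Longrightarrow> r \<in> C \<Longrightarrow> q \<le> r \<or> r \<le> q"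
      using C by (auto simp: Chains_def relation_of_def R_def)
    show "\<exists>u\<in>S. \<forall>a\<in>C. R a u"
    proof (cases "C = {}")
      case True
      have "sublinear_reduce p v \<in> S" using sublinear_sublinear_reduce[OF p] by (simp add: S_def)
      with True show ?thesis by auto
    next
      case False
      define u where "u x = (INF q\<in>C. q x)" for x
      \<comment> \<open>A chain cannot descend to minus infinity: \<open>q x \<ge> - q (- x)\<close>
        turns the common upper bound at \<open>- x\<close> into a lower bound at
        \<open>x\<close>.\<close>
      have bdd: "bdd_below ((\<lambda>q. q x) ` C)" for x
      proof (rule bdd_belowI2)
        fix q assume "q \<in> C"
        then have "sublinear q" "q (- x) \<le> sublinear_reduce p v (- x)"
          using CS by (auto simp: S_def le_fun_def)
        then show "- sublinear_reduce p v (- x) \<le> q x" using sublinear_uminus_ge[of q x] by linarith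
      qed
      have ule: "u x \<le> q x" if "q \<in> C" for q x
        unfolding u_def using that by (intro cINF_lower bdd)
      have ugr: "c \<le> u x" if "\<And>q. q \<in> C \<Longrightarrow> c \<le> q x" for c x
        unfolding u_def using that False by (intro cINF_greatest) auto
      have "sublinear u"
        unfolding sublinear_def
      proof (intro conjI allI impI)
        fix x y
        \<comment> \<open>The infima at \<open>x\<close> and at \<open>y\<close> may be approached
          along different members of the chain; the smaller of \<open>q\<close> and \<open>r\<close>
          serves at both points.\<close>
        have *: "u (x + y) \<le> q x + r y" if "q \<in> C" "r \<in> C" for q r
        proof -
          have "u (x + y) \<le> s x + s y" if "s \<in> C" for s
            using ule[OF that, of "x + y"] that CS sublinear_add[of s x y] by (force simp: S_def)
          from tot[OF that] this[OF that(1)] this[OF that(2)] show ?thesis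
            by (auto simp: le_fun_def intro: order_trans add_mono)
        qed
        have "u (x + y) - q x \<le> u y" if "q \<in> C" for q
          by (rule ugr) (use *[OF that] in \<open>simp add: algebra_simps\<close>)
        then have "u (x + y) - u y \<le> u x"
          by (intro ugr) (simp add: algebra_simps)
        then show "u (x + y) \<le> u x + u y" by simp
      next
        fix c :: real and x assume c: "c \<ge> 0"
        have q: "q (c *\<^sub>R x) = c * q x" if "q \<in> C" for q
          using that CS c sublinear_scaleR[of q c x] by (auto simp: S_def)
        show "u (c *\<^sub>R x) = c * u x"
        proof (cases "c = 0")
          case True
          then have "(\<lambda>q. q (c *\<^sub>R x)) ` C = {0}" using q False True by (force simp: image_iff)
          then show ?thesis using True by (simp add: u_def)
        next
          case False
          with c have c: "c > 0" by simp
          have "u (c *\<^sub>R x) / c \<le> u x"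
            by (rule ugr) (use ule[of _ "c *\<^sub>R x"] q c in \<open>auto simp: field_simps\<close>)
          moreover have "c * u x \<le> u (c *\<^sub>R x)"
          proof (rule ugr)
            fix r assume r: "r \<in> C"
            then show "c * u x \<le> r (c *\<^sub>R x)"
              using mult_left_mono[OF ule[OF r, of x], of c] q[OF r] c by simp
          qed
          ultimately show ?thesis using c by (simp add: field_simps)
        qed
      qed
      moreover have "u \<le> sublinear_reduce p v"
      proof -
        from False obtain q where "q \<in> C" by auto
        with ule CS show ?thesis by (force simp: S_def le_fun_def intro: order_trans)
      qed
      ultimately show ?thesis using ule by (auto simp: S_def R_def le_fun_def)
    qed
  qed
  then obtain \<phi> where \<phi>: "\<phi> \<in> S" and min: "\<And>q. q \<in> S \<Longrightarrow> q \<le> \<phi> \<Longrightarrow> q = \<phi>"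
    by (auto simp: R_def)
  have sub: "sublinear \<phi>" and le: "\<And>x. \<phi> x \<le> sublinear_reduce p v x"
    using \<phi> by (auto simp: S_def le_fun_def)
  have odd: "\<phi> (- w) = - \<phi> w" for w
  proof -
    have "sublinear_reduce \<phi> w = \<phi>"
      using sublinear_sublinear_reduce[OF sub] sublinear_reduce_le_self[OF sub] order_trans[OF sublinear_reduce_le_self[OF sub] le]
      by (intro min) (auto simp: S_def le_fun_def)
    then have "\<phi> (- w) \<le> - \<phi> w" using sublinear_reduce_uminus[OF sub, of w] by simp
    with sublinear_uminus_ge[OF sub, of w] show ?thesis by simp
  qed
  show thesis
  proof
    show "linear \<phi>"
    proof (rule linearI)
      show "\<phi> (x + y) = \<phi> x + \<phi> y" for x y
        using sublinear_add[OF sub, of x y] sublinear_add[OF sub, of "- x" "- y"]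
          odd[of x] odd[of y] odd[of "x + y"] by simp
      show "\<phi> (c *\<^sub>R x) = c *\<^sub>R \<phi> x" for c x
        using sublinear_scaleR[OF sub, of c x] sublinear_scaleR[OF sub, of "- c" x] odd[of "c *\<^sub>R x"]
        by (cases "c \<ge> 0") auto
    qed
    show "\<phi> x \<le> p x" for x using le[of x] sublinear_reduce_le_self[OF p, of v x] by linarith
    then show "\<phi> v = p v"
      using le[of "- v"] sublinear_reduce_uminus[OF p, of v] odd[of v] by (intro antisym) auto
  qed
qed

corollary Hahn_Banach_norming:
  fixes v :: "'a::real_normed_vector"
  obtains \<phi> :: "'a \<Rightarrow> real" where "bounded_linear \<phi>" "\<And>x. \<bar>\<phi> x\<bar> \<le> norm x" "\<phi> v = norm v"
proof -
  have "sublinear (norm :: 'a \<Rightarrow> real)" by (auto simp: sublinear_def norm_triangle_ineq)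
  then obtain \<phi> :: "'a \<Rightarrow> real" where \<phi>: "linear \<phi>" "\<And>x. \<phi> x \<le> norm x" "\<phi> v = norm v"
    using Hahn_Banach_sublinear by blast
  have "\<bar>\<phi> x\<bar> \<le> norm x" for x
    using \<phi>(2)[of x] \<phi>(2)[of "- x"] linear_neg[OF \<phi>(1), of x] by simp
  moreover then have "bounded_linear \<phi>"
    using \<phi>(1) by (intro bounded_linear_intro[of _ 1]) (auto simp: linear_add linear_scale)
  ultimately show thesis using that \<phi>(3) by blast
qed

text \<open>The distance to \<open>N\<close> is sublinear, at most the norm, zero on
  \<open>N\<close> and positive off \<open>N\<close>. A linear functional below it that agrees with
  it at \<open>v\<close> therefore has all the required properties.\<close>

corollary Hahn_Banach_separate_subspace:
  fixes v :: "'a::real_normed_vector"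
  assumes N: "subspace N" "closed N" and v: "v \<notin> N"
  obtains \<phi> :: "'a \<Rightarrow> real" where "bounded_linear \<phi>" "\<And>x. x \<in> N \<Longrightarrow> \<phi> x = 0" "\<phi> v \<noteq> 0"
proof -
  define p where "p x = infdist x N" for x
  have ne: "N \<noteq> {}" using subspace_0[OF N(1)] by auto
  have ple: "p x \<le> norm (x - n)" if "n \<in> N" for x n
    using infdist_le[OF that, of x] by (simp add: p_def dist_norm)
  have pgr: "c \<le> p x" if "\<And>n. n \<in> N \<Longrightarrow> c \<le> norm (x - n)" for c x
    unfolding p_def infdist_notempty[OF ne] using ne that by (intro cINF_greatest) (auto simp: dist_norm)
  have p0: "p x = 0" if "x \<in> N" for x using that by (simp add: p_def)
  have sub: "sublinear p"
    unfolding sublinear_def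
  proof (intro conjI allI impI)
    fix x y
    have "p (x + y) \<le> norm (x - m) + norm (y - n)" if "m \<in> N" "n \<in> N" for m n
      using ple[OF subspace_add[OF N(1) that], of "x + y"] norm_triangle_ineq[of "x - m" "y - n"]
      by (simp add: algebra_simps)
    then have "p (x + y) - norm (x - m) \<le> p y" if "m \<in> N" for m
      by (intro pgr) (use that in \<open>auto simp: algebra_simps\<close>)
    then have "p (x + y) - p y \<le> p x"
      by (intro pgr) (auto simp: algebra_simps)
    then show "p (x + y) \<le> p x + p y" by simp
  next
    fix c :: real and x assume "c \<ge> 0"
    have le: "p (d *\<^sub>R x) \<le> d * p x" if "d > 0" for d x
    proof -
      have "p (d *\<^sub>R x) / d \<le> norm (x - n)" if "n \<in> N" for n
      proof -
        have "norm (d *\<^sub>R x - d *\<^sub>R n) = d * norm (x - n)"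
          using \<open>d > 0\<close> by (simp flip: scaleR_diff_right)
        then show ?thesis
          using ple[OF subspace_scale[OF N(1) that, of d], of "d *\<^sub>R x"] \<open>d > 0\<close>
          by (simp add: field_simps)
      qed
      then have "p (d *\<^sub>R x) / d \<le> p x" by (rule pgr)
      with that show ?thesis by (simp add: field_simps)
    qed
    show "p (c *\<^sub>R x) = c * p x"
    proof (cases "c = 0")
      case True
      then show ?thesis using p0[OF subspace_0[OF N(1)]] by simp
    next
      case False
      with \<open>c \<ge> 0\<close> have "c > 0" by simp
      moreover have "p x \<le> p (c *\<^sub>R x) / c" using le[of "1 / c" "c *\<^sub>R x"] \<open>c > 0\<close> by simp
      ultimately show ?thesis using le[of c x] by (simp add: field_simps)
    qed
  qed
  then obtain \<phi> where \<phi>: "linear \<phi>" "\<And>x. \<phi> x \<le> p x" "\<phi> v = p v"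
    using Hahn_Banach_sublinear by blast
  have neg: "\<phi> (- x) = - \<phi> x" for x using \<phi>(1) by (simp add: linear_neg)
  have "p x \<le> norm x" for x using ple[OF subspace_0[OF N(1)], of x] by simp
  then have "\<bar>\<phi> x\<bar> \<le> norm x" for x
    using \<phi>(2)[of x] \<phi>(2)[of "- x"] neg[of x] by (smt (verit) norm_minus_cancel)
  then have "bounded_linear \<phi>"
    using \<phi>(1) by (intro bounded_linear_intro[of _ 1]) (auto simp: linear_add linear_scale)
  moreover have "\<phi> x = 0" if "x \<in> N" for x
    using \<phi>(2)[of x] \<phi>(2)[of "- x"] neg[of x] p0[OF that] p0[OF subspace_neg[OF N(1) that]] by simp
  moreover have "\<phi> v \<noteq> 0"
    using v N(2) ne \<phi>(3) by (simp add: p_def in_closed_iff_infdist_zero)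
  ultimately show thesis using that by blast
qed

text \<open>By Baire's theorem one of the sets \<open>F m\<close> contains a ball, and differences
  of points of that ball turn the pointwise bound into a bound on norms. The intended
  \<open>'b\<close> is a dual space, with Abel means as the functionals on it.\<close>

theorem uniform_boundedness:
  fixes L :: "nat \<Rightarrow> 'b::banach \<Rightarrow> real"
  assumes lin: "\<And>n. bounded_linear (L n)" and pt: "\<And>x. \<exists>C. \<forall>n. \<bar>L n x\<bar> \<le> C"
  obtains C where "\<And>n x. \<bar>L n x\<bar> \<le> C * norm x"
proof -
  define F where "F m = {x. \<forall>n. \<bar>L n x\<bar> \<le> real m}" for m :: nat
  have cl: "closed (F m)" for m
  proof -
    have "F m = (\<Inter>n. {x. \<bar>L n x\<bar> \<le> real m})" by (auto simp: F_def)
    also have "closed \<dots>"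
      using lin by (intro closed_INT ballI closed_Collect_le continuous_intros
          linear_continuous_on) auto
    finally show ?thesis .
  qed
  have UN: "(\<Union>m. F m) = UNIV"
  proof (intro equalityI subsetI UNIV_I)
    fix x
    obtain C where C: "\<And>n. \<bar>L n x\<bar> \<le> C" using pt by blast
    obtain m where "C \<le> real m" using real_arch_simple by blast
    then have "x \<in> F m" using C order_trans by (auto simp: F_def)
    then show "x \<in> (\<Union>m. F m)" by blast
  qed
  have "\<exists>m. interior (F m) \<noteq> {}"
  proof (rule ccontr)
    assume "\<nexists>m. interior (F m) \<noteq> {}"
    then have "euclidean interior_of \<Union>(range F) = {}"
      using cl by (intro Baire_category_alt disjI1 completely_metrizable_space_euclidean) auto
    with UN show False by simp
  qed
  then obtain m x0 where "x0 \<in> interior (F m)" by auto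
  then obtain e where e: "e > 0" "cball x0 e \<subseteq> F m" by (auto simp: mem_interior_cball)
  have "\<bar>L n x\<bar> \<le> 2 * real m / e * norm x" for n x
  proof (cases "x = 0")
    case True
    then show ?thesis using linear_0[OF bounded_linear.linear[OF lin]] by simp
  next
    case False
    interpret bounded_linear "L n" by (rule lin)
    \<comment> \<open>Norm exactly \<open>e\<close> keeps \<open>x0 + u\<close> in the closed ball;
      the factor \<open>2\<close> arises from subtracting the values at \<open>x0 + u\<close> and at
      \<open>x0\<close>.\<close>
    define u where "u = (e / norm x) *\<^sub>R x"
    have nu: "norm u = e" using False e by (simp add: u_def)
    have "x0 + u \<in> F m" "x0 \<in> F m" using e nu by (auto simp: dist_norm)
    then have "\<bar>L n (x0 + u)\<bar> \<le> real m" "\<bar>L n x0\<bar> \<le> real m" by (auto simp: F_def)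
    then have "\<bar>L n u\<bar> \<le> 2 * real m" by (simp add: add)
    then have "e / norm x * \<bar>L n x\<bar> \<le> 2 * real m"
      using e False by (simp add: u_def scale abs_mult)
    then show ?thesis using e False by (simp add: field_simps)
  qed
  then show thesis by (rule that)
qed

subsection \<open>Functionals determined by their values on exponentials\<close>

definition bounded_cont :: "(real \<Rightarrow> real) \<Rightarrow> bool" where
  "bounded_cont W \<longleftrightarrow> continuous_on {0..} W \<and> (\<exists>C. \<forall>u\<ge>0. \<bar>W u\<bar> \<le> C)"

text \<open>Linearity together with continuity under bounded pointwise convergence is what
  integration against a bounded signed measure provides. Working with this abstract property treats
  densities, primitives and \<open>level\<close> alike, without constructing the measure behind each
  of them.\<close>

definition normal_functional :: "((real \<Rightarrow> real) \<Rightarrow> real) \<Rightarrow> bool" where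
  "normal_functional \<Gamma> \<longleftrightarrow>
     (\<forall>V W c d. bounded_cont V \<longrightarrow> bounded_cont W \<longrightarrow>
        \<Gamma> (\<lambda>u. c * V u + d * W u) = c * \<Gamma> V + d * \<Gamma> W) \<and>
     (\<forall>V W C. (\<forall>n. continuous_on {0..} (V n)) \<longrightarrow> continuous_on {0..} W \<longrightarrow>
        (\<forall>n. \<forall>u\<ge>0. \<bar>V n u\<bar> \<le> C) \<longrightarrow> (\<forall>u\<ge>0. (\<lambda>n. V n u) \<longlonglongrightarrow> W u) \<longrightarrow>
        (\<lambda>n. \<Gamma> (V n)) \<longlonglongrightarrow> \<Gamma> W)"

lemma bounded_contI:
  "continuous_on {0..} W \<Longrightarrow> (\<And>u. u \<ge> 0 \<Longrightarrow> \<bar>W u\<bar> \<le> C) \<Longrightarrow> bounded_cont W"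
  by (auto simp: bounded_cont_def)

lemma bounded_contE:
  assumes "bounded_cont W"
  obtains C where "C \<ge> 0" "\<And>u. u \<ge> 0 \<Longrightarrow> \<bar>W u\<bar> \<le> C"
  using assms unfolding bounded_cont_def by (meson abs_ge_zero order_refl order_trans)

lemma bounded_cont_exp: "z \<ge> 0 \<Longrightarrow> bounded_cont (\<lambda>u. exp (- z * u))"
  by (rule bounded_contI[of _ 1]) (auto intro!: continuous_intros)

lemma bounded_cont_lincomb:
  assumes "bounded_cont V" "bounded_cont W"
  shows "bounded_cont (\<lambda>u. c * V u + d * W u)"
proof -
  obtain C D where *: "\<And>u. u \<ge> 0 \<Longrightarrow> \<bar>V u\<bar> \<le> C" "\<And>u. u \<ge> 0 \<Longrightarrow> \<bar>W u\<bar> \<le> D"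
    using assms bounded_contE by metis
  show ?thesis
  proof (rule bounded_contI)
    show "continuous_on {0..} (\<lambda>u. c * V u + d * W u)"
      using assms by (auto simp: bounded_cont_def intro!: continuous_intros)
    show "\<bar>c * V u + d * W u\<bar> \<le> \<bar>c\<bar> * C + \<bar>d\<bar> * D" if "u \<ge> 0" for u
      using abs_triangle_ineq[of "c * V u" "d * W u"] *[OF that]
        mult_left_mono[of "\<bar>V u\<bar>" C "\<bar>c\<bar>"] mult_left_mono[of "\<bar>W u\<bar>" D "\<bar>d\<bar>"]
      by (auto simp: abs_mult)
  qed
qed

lemma normal_functional_lincomb:
  "normal_functional \<Gamma> \<Longrightarrow> bounded_cont V \<Longrightarrow> bounded_cont W \<Longrightarrow>
    \<Gamma> (\<lambda>u. c * V u + d * W u) = c * \<Gamma> V + d * \<Gamma> W"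
  by (simp add: normal_functional_def)

lemma normal_functional_tendsto:
  assumes "normal_functional \<Gamma>" "\<And>n. continuous_on {0..} (V n)" "continuous_on {0..} W"
    "\<And>n u. u \<ge> 0 \<Longrightarrow> \<bar>V n u\<bar> \<le> C" "\<And>u. u \<ge> 0 \<Longrightarrow> (\<lambda>n. V n u) \<longlonglongrightarrow> W u"
  shows "(\<lambda>n. \<Gamma> (V n)) \<longlonglongrightarrow> \<Gamma> W"
  using assms unfolding normal_functional_def by blast

lemma bounded_cont_sum:
  assumes "\<And>i. i \<in> I \<Longrightarrow> bounded_cont (W i)"
  shows "bounded_cont (\<lambda>u. \<Sum>i\<in>I. c i * W i u)"
  using assms
proof (induction I rule: infinite_finite_induct)
  case (insert i I)
  then show ?case
    using bounded_cont_lincomb[of "W i" "\<lambda>u. \<Sum>i\<in>I. c i * W i u" "c i" 1] by simp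
qed (auto intro: bounded_contI[of _ 0])

lemma normal_functional_sum:
  assumes "normal_functional \<Gamma>" "\<And>i. i \<in> I \<Longrightarrow> bounded_cont (W i)"
  shows "\<Gamma> (\<lambda>u. \<Sum>i\<in>I. c i * W i u) = (\<Sum>i\<in>I. c i * \<Gamma> (W i))"
  using assms(2)
proof (induction I rule: infinite_finite_induct)
  case (insert i I)
  then show ?case
    using normal_functional_lincomb[OF assms(1), of "W i" "\<lambda>u. \<Sum>i\<in>I. c i * W i u" "c i" 1]
      bounded_cont_sum[of I W c] by simp
next
  case (infinite I)
  have "bounded_cont (\<lambda>_. 0)" by (rule bounded_contI[of _ 0]) auto
  from normal_functional_lincomb[OF assms(1) this this, of 0 0] infinite show ?case by simp
next
  case empty
  have "bounded_cont (\<lambda>_. 0)" by (rule bounded_contI[of _ 0]) auto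
  from normal_functional_lincomb[OF assms(1) this this, of 0 0] show ?case by simp
qed

section \<open>Correlation with \<mu> and its Abel limits\<close>

definition laplace_conv :: "real measure \<Rightarrow> (real \<Rightarrow> real) \<Rightarrow> real \<Rightarrow> real" where
  "laplace_conv \<mu> F r = (LINT s:{0..}|\<mu>. F (s + r))"

context
  fixes \<mu> :: "real measure"
  assumes mu: "radon_Rplus \<mu>" "laplace_transformable \<mu>"
begin

lemma sets_mu: "sets \<mu> = sets borel"
  using mu by (simp add: radon_Rplus_def)

lemma shift_measurable:
  fixes F :: "real \<Rightarrow> real"
  assumes "continuous_on {0..} F" "r \<ge> 0"
  shows "set_borel_measurable \<mu> {0..} (\<lambda>s. F (s + r))"
proof -
  have "continuous_on {0..} (\<lambda>s. F (s + r))"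
    by (rule continuous_on_compose2[OF assms(1)]) (use assms in \<open>auto intro!: continuous_intros\<close>)
  then have "(\<lambda>s. indicator {0..} s *\<^sub>R F (s + r)) \<in> borel_measurable borel"
    using borel_measurable_continuous_on_indicator[of "{0..}" "\<lambda>s. F (s + r)"] by simp
  then show ?thesis
    unfolding set_borel_measurable_def using measurable_cong_sets[OF sets_mu refl] by blast
qed

lemma shift_integrable:
  assumes F: "continuous_on {0..} F" "\<And>u. u \<ge> 0 \<Longrightarrow> \<bar>F u\<bar> \<le> C * exp (- \<beta> * u)"
    and \<beta>: "\<beta> > 0" and r: "r \<ge> 0"
  shows "set_integrable \<mu> {0..} (\<lambda>s. F (s + r))"
    and "\<bar>laplace_conv \<mu> F r\<bar> \<le> C * exp (- \<beta> * r) * laplace \<mu> \<beta>"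
proof -
  have e: "set_integrable \<mu> {0..} (\<lambda>s. exp (- s * \<beta>))"
    using mu \<beta> by (simp add: laplace_transformable_def)
  then have i: "set_integrable \<mu> {0..} (\<lambda>s. C * exp (- \<beta> * r) * exp (- s * \<beta>))"
    by (rule set_integrable_mult_right)
  have le: "\<bar>F (s + r)\<bar> \<le> C * exp (- \<beta> * r) * exp (- s * \<beta>)" if "s \<ge> 0" for s
    using F(2)[of "s + r"] r that by (simp add: algebra_simps flip: exp_add)
  show *: "set_integrable \<mu> {0..} (\<lambda>s. F (s + r))"
    using i unfolding set_integrable_def
  proof (rule Bochner_Integration.integrable_bound)
    show "(\<lambda>s. indicator {0..} s *\<^sub>R F (s + r)) \<in> borel_measurable \<mu>"
      using shift_measurable[OF F(1) r] by (simp add: set_borel_measurable_def)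
    show "AE s in \<mu>. norm (indicator {0..} s *\<^sub>R F (s + r))
        \<le> norm (indicator {0..} s *\<^sub>R (C * exp (- \<beta> * r) * exp (- s * \<beta>)))"
    proof (rule AE_I2)
      fix s
      show "norm (indicator {0..} s *\<^sub>R F (s + r))
        \<le> norm (indicator {0..} s *\<^sub>R (C * exp (- \<beta> * r) * exp (- s * \<beta>)))"
        using order_trans[OF le[of s] abs_ge_self] by (cases "s \<ge> 0") auto
    qed
  qed
  have "\<bar>laplace_conv \<mu> F r\<bar> \<le> (LINT s:{0..}|\<mu>. \<bar>F (s + r)\<bar>)"
    unfolding laplace_conv_def using set_integral_norm_bound[OF *] by simp
  also have "\<dots> \<le> (LINT s:{0..}|\<mu>. C * exp (- \<beta> * r) * exp (- s * \<beta>))"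
    using le by (intro set_integral_mono set_integrable_abs[OF *] i) auto
  also have "\<dots> = C * exp (- \<beta> * r) * laplace \<mu> \<beta>"
    by (simp add: laplace_def)
  finally show "\<bar>laplace_conv \<mu> F r\<bar> \<le> C * exp (- \<beta> * r) * laplace \<mu> \<beta>" .
qed

lemma laplace_conv_continuous:
  assumes F: "continuous_on {0..} F" "\<And>u. u \<ge> 0 \<Longrightarrow> \<bar>F u\<bar> \<le> C * exp (- \<beta> * u)"
    and \<beta>: "\<beta> > 0"
  shows "continuous_on {0..} (laplace_conv \<mu> F)"
  unfolding continuous_on_sequentially
proof (intro allI ballI impI, elim conjE)
  fix X :: "nat \<Rightarrow> real" and r
  assume r: "r \<in> {0..}" and X: "\<forall>n. X n \<in> {0..}" "X \<longlonglongrightarrow> r"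
  have e: "set_integrable \<mu> {0..} (\<lambda>s. exp (- s * \<beta>))"
    using mu \<beta> by (simp add: laplace_transformable_def)
  have C: "C \<ge> 0" using F(2)[of 0] by simp
  have le: "\<bar>F (s + t)\<bar> \<le> C * exp (- s * \<beta>)" if "s \<ge> 0" "t \<ge> 0" for s t
  proof -
    have "exp (- \<beta> * (s + t)) \<le> exp (- s * \<beta>)" using \<beta> that by (simp add: algebra_simps)
    then show ?thesis using F(2)[of "s + t"] that C by (meson add_nonneg_nonneg mult_left_mono order_trans)
  qed
  show "((laplace_conv \<mu> F) \<circ> X) \<longlonglongrightarrow> laplace_conv \<mu> F r"
    unfolding comp_def laplace_conv_def set_lebesgue_integral_def
  proof (rule integral_dominated_convergence[where w = "\<lambda>s. indicator {0..} s *\<^sub>R (C * exp (- s * \<beta>))"])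
    show "(\<lambda>s. indicator {0..} s *\<^sub>R F (s + r)) \<in> borel_measurable \<mu>"
      using shift_measurable[OF F(1)] r by (simp add: set_borel_measurable_def)
    show "(\<lambda>s. indicator {0..} s *\<^sub>R F (s + X n)) \<in> borel_measurable \<mu>" for n
      using shift_measurable[OF F(1)] X by (simp add: set_borel_measurable_def)
    show "integrable \<mu> (\<lambda>s. indicator {0..} s *\<^sub>R (C * exp (- s * \<beta>)))"
      using set_integrable_mult_right[OF e, of C] by (simp add: set_integrable_def)
    show "AE s in \<mu>. norm (indicator {0..} s *\<^sub>R F (s + X n)) \<le> indicator {0..} s *\<^sub>R (C * exp (- s * \<beta>))" for n
      by (intro AE_I2) (use le X in \<open>auto simp: indicator_def\<close>)
    have "(\<lambda>n. F (s + X n)) \<longlonglongrightarrow> F (s + r)" if "s \<ge> 0" for s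
      by (rule continuous_on_tendsto_compose[OF F(1)]) (use that X r in \<open>auto intro!: tendsto_intros\<close>)
    then show "AE s in \<mu>. (\<lambda>n. indicator {0..} s *\<^sub>R F (s + X n)) \<longlonglongrightarrow> indicator {0..} s *\<^sub>R F (s + r)"
      by (intro AE_I2) (auto simp: indicator_def)
  qed
qed

text \<open>Both sides are continuous in \<open>F\<close>, so it suffices to take linear combinations of exponentials;
  these are dense by Weierstrass' theorem in the variable \<open>exp (- u)\<close>.\<close>

lemma normal_functional_laplace_conv:
  assumes \<Gamma>: "normal_functional \<Gamma>" and \<Lambda>: "normal_functional \<Lambda>"
    and eq: "\<And>z. z > 0 \<Longrightarrow> laplace \<mu> z * \<Gamma> (\<lambda>u. exp (- z * u)) = \<Lambda> (\<lambda>u. exp (- z * u))"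
    and F: "continuous_on {0..} F" "\<And>u. u \<ge> 0 \<Longrightarrow> \<bar>F u\<bar> \<le> C * exp (- \<alpha> * u)"
    and \<alpha>: "\<alpha> > 0"
  shows "\<Lambda> F = \<Gamma> (laplace_conv \<mu> F)"
proof -
  \<comment> \<open>Half of the decay is kept as a weight that makes all approximants integrable
    against \<mu>; the other half makes the function to be approximated vanish at infinity.\<close>
  define \<beta> where "\<beta> = \<alpha> / 2"
  have \<beta>: "\<beta> > 0" "\<alpha> = \<beta> + \<beta>" using \<alpha> by (auto simp: \<beta>_def)
  have C: "C \<ge> 0" using F(2)[of 0] by simp
  \<comment> \<open>In the variable \<open>x = exp (- u)\<close> this is
    \<open>F u * exp (\<beta> * u)\<close>, and \<open>x = 0\<close> is the point
    \<open>u = \<infinity>\<close>. The remaining decay makes the value \<open>0\<close> there the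
    continuous one.\<close>
  define q where "q x = (if x = 0 then 0 else F (- ln x) * x powr (- \<beta>))" for x
  have q_exp: "q (exp (- u)) = F u * exp (\<beta> * u)" for u
    by (simp add: q_def powr_def)
  have q_le: "\<bar>q x\<bar> \<le> C * x powr \<beta>" if "0 < x" "x \<le> 1" for x
  proof -
    have "\<bar>F (- ln x)\<bar> \<le> C * exp (- \<alpha> * (- ln x))"
      using F(2)[of "- ln x"] that by simp
    then have "\<bar>q x\<bar> \<le> C * exp (- \<alpha> * (- ln x)) * x powr (- \<beta>)"
      using that by (simp add: q_def abs_mult mult_right_mono)
    also have "\<dots> = C * x powr \<beta>"
      using that by (simp add: powr_def \<beta>(2) algebra_simps flip: exp_add)
    finally show ?thesis .
  qed
  have "continuous_on {0<..1} (\<lambda>x. F (- ln x) * x powr (- \<beta>))"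
    by (intro continuous_intros continuous_on_compose2[OF F(1)]) auto
  then have q1: "continuous_on {0<..1} q"
    by (rule continuous_on_eq) (auto simp: q_def)
  have qc: "continuous_on {0..1} q"
    unfolding continuous_on_eq_continuous_within
  proof
    fix x :: real assume x: "x \<in> {0..1}"
    show "continuous (at x within {0..1}) q"
    proof (cases "x = 0")
      case True
      have "((\<lambda>x. C * x powr \<beta>) \<longlongrightarrow> C * 0 powr \<beta>) (at 0 within {0..1})"
        using \<beta> by (intro tendsto_intros) (auto simp: eventually_at_filter)
      then have l: "((\<lambda>x. C * x powr \<beta>) \<longlongrightarrow> 0) (at 0 within {0..1})" using \<beta> by simp
      have "(q \<longlongrightarrow> 0) (at 0 within {0..1})"
        by (rule Lim_null_comparison[OF _ l])
          (use q_le in \<open>auto simp: eventually_at_filter intro!: always_eventually\<close>)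
      then show ?thesis using True by (simp add: continuous_within q_def)
    next
      case False
      have "at x within {0..1} = at x within {0<..1}"
        by (rule at_within_nhd[of x "{0<..}"]) (use x False in auto)
      then show ?thesis using q1 x False by (simp add: continuous_on_eq_continuous_within)
    qed
  qed
  have "\<exists>a N. \<forall>x\<in>{0..1}. \<bar>q x - (\<Sum>i\<le>N. a i * x ^ i)\<bar> \<le> inverse (Suc n)" for n
  proof -
    obtain g where g: "real_polynomial_function g" "\<And>x. x \<in> {0..1} \<Longrightarrow> \<bar>q x - g x\<bar> < inverse (Suc n)"
      using Stone_Weierstrass_real_polynomial_function[OF compact_Icc qc, of "inverse (Suc n)"] by auto
    then obtain a N where "g = (\<lambda>x. \<Sum>i\<le>N. a i * x ^ i)"
      by (auto simp: real_polynomial_function_iff_sum)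
    with g(2) show ?thesis by (metis less_imp_le)
  qed
  then obtain a N where aN: "\<And>n x. x \<in> {0..1} \<Longrightarrow> \<bar>q x - (\<Sum>i\<le>N n. a n i * x ^ i)\<bar> \<le> inverse (Suc n)"
    by metis
  \<comment> \<open>Undoing the weight moves every exponent up by \<beta>, so even the constant term
    of the polynomial becomes an exponential with positive rate, to which \<open>eq\<close>
    applies.\<close>
  define P where "P n u = (\<Sum>i\<le>N n. a n i * exp (- (\<beta> + real i) * u))" for n u
  have P_eq: "P n u = exp (- \<beta> * u) * (\<Sum>i\<le>N n. a n i * exp (- u) ^ i)" for n u
    by (simp add: P_def sum_distrib_left algebra_simps flip: exp_of_nat_mult exp_add)
  have FP: "\<bar>P n u - F u\<bar> \<le> inverse (Suc n) * exp (- \<beta> * u)" if "u \<ge> 0" for n u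
  proof -
    have "\<bar>P n u - F u\<bar> = exp (- \<beta> * u) * \<bar>q (exp (- u)) - (\<Sum>i\<le>N n. a n i * exp (- u) ^ i)\<bar>"
      unfolding P_eq q_exp
      by (subst abs_of_nonneg[of "exp (- \<beta> * u)", symmetric], simp, subst abs_mult[symmetric])
        (simp add: algebra_simps abs_minus_commute flip: exp_add)
    also have "\<dots> \<le> exp (- \<beta> * u) * inverse (Suc n)"
      using that by (intro mult_left_mono aN) auto
    finally show ?thesis by (simp add: mult.commute)
  qed
  have bc: "bounded_cont (\<lambda>u. exp (- (\<beta> + real i) * u))" for i
    using \<beta> by (intro bounded_cont_exp) simp
  have Pc: "continuous_on {0..} (P n)" for n
    unfolding P_def by (intro continuous_intros)
  \<comment> \<open>Exponentials are eigenfunctions of the correlation with \<mu>, with eigenvalue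
    \<open>laplace \<mu> z\<close>; this is the reason why the hypothesis \<open>eq\<close> is the
    right one.\<close>
  have conv_exp: "set_integrable \<mu> {0..} (\<lambda>s. exp (- z * (s + r)))"
    "laplace_conv \<mu> (\<lambda>u. exp (- z * u)) r = laplace \<mu> z * exp (- z * r)" if "z > 0" for z r
  proof -
    have *: "exp (- z * (s + r)) = exp (- z * r) * exp (- s * z)" for s
      by (simp add: algebra_simps flip: exp_add)
    have e: "set_integrable \<mu> {0..} (\<lambda>s. exp (- s * z))"
      using mu that by (simp add: laplace_transformable_def)
    show "set_integrable \<mu> {0..} (\<lambda>s. exp (- z * (s + r)))"
      unfolding * using e by (rule set_integrable_mult_right)
    show "laplace_conv \<mu> (\<lambda>u. exp (- z * u)) r = laplace \<mu> z * exp (- z * r)"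
      unfolding laplace_conv_def * by (simp add: laplace_def)
  qed
  have conv_P: "laplace_conv \<mu> (P n) = (\<lambda>r. \<Sum>i\<le>N n. a n i * laplace \<mu> (\<beta> + real i) * exp (- (\<beta> + real i) * r))" for n
  proof
    fix r
    have "laplace_conv \<mu> (P n) r = (LINT s:{0..}|\<mu>. (\<Sum>i\<le>N n. a n i * exp (- (\<beta> + real i) * (s + r))))"
      by (simp add: laplace_conv_def P_def)
    also have "\<dots> = (\<Sum>i\<le>N n. LINT s:{0..}|\<mu>. a n i * exp (- (\<beta> + real i) * (s + r)))"
    proof -
      have "set_integrable \<mu> {0..} (\<lambda>s. a n i * exp (- (\<beta> + real i) * (s + r)))" for i
        using \<beta> by (intro set_integrable_mult_right conv_exp) auto
      then show ?thesis
        unfolding set_lebesgue_integral_def scaleR_sum_right set_integrable_def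
        by (intro Bochner_Integration.integral_sum) auto
    qed
    also have "\<dots> = (\<Sum>i\<le>N n. a n i * laplace_conv \<mu> (\<lambda>u. exp (- (\<beta> + real i) * u)) r)"
      by (simp add: laplace_conv_def)
    also have "\<dots> = (\<Sum>i\<le>N n. a n i * laplace \<mu> (\<beta> + real i) * exp (- (\<beta> + real i) * r))"
      using \<beta> by (intro sum.cong refl) (subst conv_exp, auto)
    finally show "laplace_conv \<mu> (P n) r = \<dots>" .
  qed
  have eqP: "\<Lambda> (P n) = \<Gamma> (laplace_conv \<mu> (P n))" for n
    unfolding conv_P unfolding P_def
  proof -
    have "\<Lambda> (\<lambda>u. exp (- (\<beta> + real i) * u)) = laplace \<mu> (\<beta> + real i) * \<Gamma> (\<lambda>u. exp (- (\<beta> + real i) * u))" for i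
      using \<beta> by (intro eq[symmetric]) simp
    then show "\<Lambda> (\<lambda>u. \<Sum>i\<le>N n. a n i * exp (- (\<beta> + real i) * u)) =
        \<Gamma> (\<lambda>r. \<Sum>i\<le>N n. a n i * laplace \<mu> (\<beta> + real i) * exp (- (\<beta> + real i) * r))"
      by (simp only: normal_functional_sum[OF \<Lambda> bc] normal_functional_sum[OF \<Gamma> bc]) (simp only: mult.assoc)
  qed
  have inv: "(\<lambda>n. inverse (real (Suc n)) * c) \<longlonglongrightarrow> 0" for c
    using tendsto_mult_left_zero[OF LIMSEQ_inverse_real_of_nat] by simp
  have inv1: "inverse (real (Suc n)) \<le> 1" for n by (simp add: field_simps)
  have expb: "exp (- \<beta> * u) \<le> 1" if "u \<ge> 0" for u using \<beta> that by simp
  have Fb: "\<bar>F u\<bar> \<le> C * exp (- \<beta> * u)" if "u \<ge> 0" for u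
  proof -
    have "exp (- \<alpha> * u) \<le> exp (- \<beta> * u)" using \<beta> that by (simp add: mult_right_mono)
    then show ?thesis using F(2)[OF that] C by (meson mult_left_mono order_trans)
  qed
  have "(\<lambda>n. \<Lambda> (P n)) \<longlonglongrightarrow> \<Lambda> F"
  proof (rule normal_functional_tendsto[OF \<Lambda> Pc F(1)])
    show "\<bar>P n u\<bar> \<le> C + 1" if "u \<ge> 0" for n u
    proof -
      have "inverse (real (Suc n)) * exp (- \<beta> * u) \<le> 1"
        using inv1 expb[OF that] by (intro mult_le_one) auto
      moreover have "C * exp (- \<beta> * u) \<le> C" using mult_left_mono[OF expb[OF that] C] by simp
      ultimately show ?thesis using FP[OF that, of n] Fb[OF that] by linarith
    qed
    show "(\<lambda>n. P n u) \<longlonglongrightarrow> F u" if "u \<ge> 0" for u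
      by (rule LIM_zero_cancel, rule Lim_null_comparison[OF always_eventually inv[of "exp (- \<beta> * u)"]])
        (use FP[OF that] in auto)
  qed
  moreover have "(\<lambda>n. \<Gamma> (laplace_conv \<mu> (P n))) \<longlonglongrightarrow> \<Gamma> (laplace_conv \<mu> F)"
  proof -
    \<comment> \<open>The weight survives uniformly in \<open>n\<close>; a bound by a constant alone
      would not be integrable against \<mu> in general.\<close>
    have PFb: "\<bar>P n u\<bar> \<le> (C + 1) * exp (- \<beta> * u)" if "u \<ge> 0" for n u
    proof -
      have "inverse (real (Suc n)) * exp (- \<beta> * u) \<le> 1 * exp (- \<beta> * u)"
        using inv1 by (intro mult_right_mono) auto
      then show ?thesis unfolding distrib_right using FP[OF that, of n] Fb[OF that] by linarith
    qed
    have diff: "\<bar>laplace_conv \<mu> (P n) r - laplace_conv \<mu> F r\<bar>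
        \<le> inverse (Suc n) * (exp (- \<beta> * r) * laplace \<mu> \<beta>)" if "r \<ge> 0" for n r
    proof -
      have "laplace_conv \<mu> (P n) r - laplace_conv \<mu> F r = laplace_conv \<mu> (\<lambda>u. P n u - F u) r"
        unfolding laplace_conv_def
        by (rule set_integral_diff(2)[symmetric])
          (rule shift_integrable[OF Pc PFb \<beta>(1) that] shift_integrable[OF F(1) Fb \<beta>(1) that], assumption?)+
      also have "\<bar>\<dots>\<bar> \<le> inverse (Suc n) * exp (- \<beta> * r) * laplace \<mu> \<beta>"
        by (rule shift_integrable(2)[OF _ FP \<beta>(1) that]) (intro continuous_intros Pc F(1))
      finally show ?thesis by (simp add: mult.assoc)
    qed
    have lap0: "laplace \<mu> \<beta> \<ge> 0"
      unfolding laplace_def set_lebesgue_integral_def by (intro Bochner_Integration.integral_nonneg) auto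
    show ?thesis
    proof (rule normal_functional_tendsto[OF \<Gamma>])
      show "continuous_on {0..} (laplace_conv \<mu> (P n))" for n
        by (rule laplace_conv_continuous[OF Pc PFb \<beta>(1)])
      show "continuous_on {0..} (laplace_conv \<mu> F)"
        by (rule laplace_conv_continuous[OF F(1) Fb \<beta>(1)])
      show "\<bar>laplace_conv \<mu> (P n) r\<bar> \<le> (C + 1) * laplace \<mu> \<beta>" if "r \<ge> 0" for n r
      proof -
        have "\<bar>laplace_conv \<mu> (P n) r\<bar> \<le> (C + 1) * exp (- \<beta> * r) * laplace \<mu> \<beta>"
          by (rule shift_integrable(2)[OF Pc PFb \<beta>(1) that])
        also have "\<dots> \<le> (C + 1) * 1 * laplace \<mu> \<beta>"
          using expb[OF that] C lap0 by (intro mult_right_mono mult_left_mono) auto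
        finally show ?thesis by simp
      qed
      show "(\<lambda>n. laplace_conv \<mu> (P n) r) \<longlonglongrightarrow> laplace_conv \<mu> F r" if "r \<ge> 0" for r
        by (rule LIM_zero_cancel,
            rule Lim_null_comparison[OF always_eventually inv[of "exp (- \<beta> * r) * laplace \<mu> \<beta>"]])
          (use diff[OF that] in auto)
    qed
  qed
  ultimately show ?thesis
    unfolding eqP by (rule LIMSEQ_unique)
qed

text \<open>The preceding lemma applies to the damped functions \<open>E n\<close>. Their
  correlation at \<open>r\<close> is \<open>exp (- \<alpha> n * r)\<close> times the Abel mean of
  the translate by \<open>r\<close>, so the damping can be removed on both sides by continuity of
  the functionals. The price is the hypothesis \<open>bound\<close>, uniform in \<open>n\<close> and
  \<open>r\<close>.\<close>

lemma normal_functional_Abel_limit: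
  assumes \<Gamma>: "normal_functional \<Gamma>" and \<Lambda>: "normal_functional \<Lambda>"
    and eq: "\<And>z. z > 0 \<Longrightarrow> laplace \<mu> z * \<Gamma> (\<lambda>u. exp (- z * u)) = \<Lambda> (\<lambda>u. exp (- z * u))"
    and F: "bounded_cont F" and G: "continuous_on {0..} G"
    and \<alpha>: "\<And>n. \<alpha> n > 0" "\<alpha> \<longlonglongrightarrow> 0"
    and bound: "\<And>n r. r \<ge> 0 \<Longrightarrow> \<bar>LINT s:{0..}|\<mu>. exp (- \<alpha> n * s) * F (s + r)\<bar> \<le> C"
    and lim: "\<And>r. r \<ge> 0 \<Longrightarrow> (\<lambda>n. LINT s:{0..}|\<mu>. exp (- \<alpha> n * s) * F (s + r)) \<longlonglongrightarrow> G r"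
  shows "\<Lambda> F = \<Gamma> G"
proof -
  define E where "E n u = exp (- \<alpha> n * u) * F u" for n u
  obtain D where D: "D \<ge> 0" "\<And>u. u \<ge> 0 \<Longrightarrow> \<bar>F u\<bar> \<le> D" using F bounded_contE by metis
  have Fc: "continuous_on {0..} F" using F by (simp add: bounded_cont_def)
  have Ec: "continuous_on {0..} (E n)" for n
    unfolding E_def by (intro continuous_intros Fc)
  have Eb: "\<bar>E n u\<bar> \<le> D * exp (- \<alpha> n * u)" if "u \<ge> 0" for n u
    using D(2)[OF that] by (simp add: E_def abs_mult mult.commute mult_left_mono)
  have exp1: "exp (- \<alpha> n * u) \<le> 1" if "u \<ge> 0" for n u
    using \<alpha>(1)[of n] that by simp
  have explim: "(\<lambda>n. exp (- \<alpha> n * u)) \<longlonglongrightarrow> 1" for u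
  proof -
    have "(\<lambda>n. exp (- \<alpha> n * u)) \<longlonglongrightarrow> exp (- 0 * u)" by (intro tendsto_intros \<alpha>(2))
    then show ?thesis by simp
  qed
  have conv: "laplace_conv \<mu> (E n) r = exp (- \<alpha> n * r) * (LINT s:{0..}|\<mu>. exp (- \<alpha> n * s) * F (s + r))" for n r
  proof -
    have *: "exp (- \<alpha> n * (s + r)) * F (s + r) = exp (- \<alpha> n * r) * (exp (- \<alpha> n * s) * F (s + r))" for s
      by (simp add: algebra_simps flip: exp_add)
    have "laplace_conv \<mu> (E n) r = (LINT s:{0..}|\<mu>. exp (- \<alpha> n * r) * (exp (- \<alpha> n * s) * F (s + r)))"
      unfolding laplace_conv_def E_def * ..
    then show ?thesis by simp
  qed
  have "\<Lambda> (E n) = \<Gamma> (laplace_conv \<mu> (E n))" for n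
    by (rule normal_functional_laplace_conv[OF \<Gamma> \<Lambda> eq Ec Eb \<alpha>(1)])
  moreover have "(\<lambda>n. \<Lambda> (E n)) \<longlonglongrightarrow> \<Lambda> F"
  proof (rule normal_functional_tendsto[OF \<Lambda> Ec Fc])
    show "\<bar>E n u\<bar> \<le> D" if "u \<ge> 0" for n u
      using Eb[OF that, of n] mult_left_mono[OF exp1[OF that] D(1), of n] by simp
    show "(\<lambda>n. E n u) \<longlonglongrightarrow> F u" for u
      unfolding E_def using tendsto_mult_right[OF explim[of u], of "F u"] by simp
  qed
  moreover have "(\<lambda>n. \<Gamma> (laplace_conv \<mu> (E n))) \<longlonglongrightarrow> \<Gamma> G"
  proof (rule normal_functional_tendsto[OF \<Gamma> laplace_conv_continuous[OF Ec Eb \<alpha>(1)] G])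
    show "\<bar>laplace_conv \<mu> (E n) r\<bar> \<le> C" if "r \<ge> 0" for n r
    proof -
      have "\<bar>laplace_conv \<mu> (E n) r\<bar> = exp (- \<alpha> n * r) * \<bar>LINT s:{0..}|\<mu>. exp (- \<alpha> n * s) * F (s + r)\<bar>"
        by (simp add: conv abs_mult)
      also have "\<dots> \<le> 1 * C" using exp1[OF that] bound[OF that] by (intro mult_mono) auto
      finally show ?thesis by simp
    qed
    show "(\<lambda>n. laplace_conv \<mu> (E n) r) \<longlonglongrightarrow> G r" if "r \<ge> 0" for r
      unfolding conv using tendsto_mult[OF explim[of r] lim[OF that]] by simp
  qed
  ultimately show ?thesis using LIMSEQ_unique by simp
qed

end

subsection \<open>Cesaro averages and Bernstein functions\<close>

definition primitive :: "(real \<Rightarrow> real) \<Rightarrow> real \<Rightarrow> real" where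
  "primitive W v = integral {0..v} W"

lemma cont_integrable_on:
  fixes W :: "real \<Rightarrow> real"
  assumes "continuous_on {0..} W" "a \<ge> 0"
  shows "W integrable_on {a..b}"
  by (rule integrable_continuous_real, rule continuous_on_subset[OF assms(1)]) (use assms in auto)

lemma primitive_diff:
  assumes "continuous_on {0..} W" "0 \<le> u" "u \<le> v"
  shows "primitive W v - primitive W u = integral {u..v} W"
  using Henstock_Kurzweil_Integration.integral_combine[of 0 u v W] cont_integrable_on[OF assms(1), of 0 v] assms
  by (simp add: primitive_def)

lemma primitive_lipschitz:
  assumes W: "continuous_on {0..} W" "\<And>u. u \<ge> 0 \<Longrightarrow> \<bar>W u\<bar> \<le> C" and uv: "0 \<le> u" "0 \<le> v"
  shows "\<bar>primitive W v - primitive W u\<bar> \<le> C * \<bar>v - u\<bar>"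
proof -
  have "\<bar>primitive W v - primitive W u\<bar> \<le> C * \<bar>v - u\<bar>" if "0 \<le> u" "u \<le> v" for u v
  proof -
    have "norm (integral {u..v} W) \<le> C * (v - u)"
      using that W(2) by (intro integral_bound continuous_on_subset[OF W(1)]) auto
    then show ?thesis using primitive_diff[OF W(1) that] that by simp
  qed
  from this[of u v] this[of v u] uv show ?thesis by (cases "u \<le> v") (auto simp: abs_minus_commute)
qed

lemma primitive_continuous:
  assumes "bounded_cont W"
  shows "continuous_on {0..} (primitive W)"
proof -
  obtain C where C: "C \<ge> 0" "\<And>u. u \<ge> 0 \<Longrightarrow> \<bar>W u\<bar> \<le> C" using assms bounded_contE by metis
  have "C-lipschitz_on {0..} (primitive W)"
    using primitive_lipschitz[of W C] assms C
    by (intro lipschitz_onI) (auto simp: dist_real_def bounded_cont_def)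
  then show ?thesis by (rule lipschitz_on_continuous_on)
qed

lemma primitive_shift:
  assumes W: "continuous_on {0..} W" and "r \<ge> 0" "v \<ge> 0"
  shows "primitive (\<lambda>u. W u - W (u + r)) v = primitive W v + primitive W r - primitive W (v + r)"
proof -
  have c: "continuous_on {0..} (\<lambda>u. W (u + r))"
    by (rule continuous_on_compose2[OF W]) (use assms in \<open>auto intro!: continuous_intros\<close>)
  have "integral {0..v} (\<lambda>u. W (u + r)) = integral {r..v + r} W"
    using integral_shift[where f=W and a=0 and b=v and c=r] continuous_on_subset[OF W, of "{r..v + r}"] assms
    by (simp add: comp_def add.commute)
  also have "\<dots> = primitive W (v + r) - primitive W r"
    using assms by (intro primitive_diff[symmetric]) auto
  finally show ?thesis
    using Henstock_Kurzweil_Integration.integral_diff[OF cont_integrable_on[OF W, of 0 v] cont_integrable_on[OF c, of 0 v]]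
    by (simp add: primitive_def)
qed

lemma primitive_exp:
  assumes "z > 0" "v \<ge> 0"
  shows "primitive (\<lambda>u. exp (- z * u)) v = (1 - exp (- z * v)) / z"
proof -
  have "((\<lambda>u. exp (- z * u)) has_integral (- exp (- z * v) / z) - (- exp (- z * 0) / z)) {0..v}"
    using assms by (intro fundamental_theorem_of_calculus)
      (auto intro!: derivative_eq_intros simp flip: has_real_derivative_iff_has_vector_derivative)
  then show ?thesis
    unfolding primitive_def by (simp add: integral_unique diff_divide_distrib)
qed

lemma primitive_lincomb:
  assumes "bounded_cont V" "bounded_cont W" 
  shows "primitive (\<lambda>u. c * V u + d * W u) v = c * primitive V v + d * primitive W v"
proof -
  have "V integrable_on {0..v}" "W integrable_on {0..v}"
    using assms by (auto simp: bounded_cont_def intro: cont_integrable_on)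
  then have "((\<lambda>u. c * V u + d * W u) has_integral c * primitive V v + d * primitive W v) {0..v}"
    unfolding primitive_def by (intro has_integral_add has_integral_mult_right integrable_integral)
  then show ?thesis unfolding primitive_def by (rule integral_unique)
qed

lemma primitive_tendsto:
  assumes "\<And>n. continuous_on {0..} (V n)" "continuous_on {0..} W"
    "\<And>n u. u \<ge> 0 \<Longrightarrow> \<bar>V n u\<bar> \<le> C" "\<And>u. u \<ge> 0 \<Longrightarrow> (\<lambda>n. V n u) \<longlonglongrightarrow> W u"
  shows "(\<lambda>n. primitive (V n) v) \<longlonglongrightarrow> primitive W v"
  unfolding primitive_def
  by (rule dominated_convergence(2)[where h = "\<lambda>_. C"]) (use assms in \<open>auto intro: cont_integrable_on\<close>)

lemma normal_functional_primitive: "normal_functional (\<lambda>W. primitive W v)"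
  unfolding normal_functional_def using primitive_lincomb primitive_tendsto by blast

lemma normal_functional_kernel:
  assumes k: "integrable lborel k"
  shows "normal_functional (\<lambda>W. LINT u:{0..}|lborel. k u * W u)"
proof -
  have meas: "(\<lambda>u. indicator {0..} u *\<^sub>R (k u * W u)) \<in> borel_measurable lborel"
    if "continuous_on {0..} W" for W :: "real \<Rightarrow> real"
  proof -
    have "(\<lambda>u. k u * (indicator {0..} u *\<^sub>R W u)) \<in> borel_measurable lborel"
      using borel_measurable_continuous_on_indicator[of "{0..}" W] that k
      by (intro borel_measurable_times) auto
    then show ?thesis by (simp add: ac_simps)
  qed
  have le: "norm (indicator {0..} u *\<^sub>R (k u * W u)) \<le> C * \<bar>k u\<bar>"
    if "\<And>u. u \<ge> 0 \<Longrightarrow> \<bar>W u\<bar> \<le> C" "C \<ge> 0" for W :: "real \<Rightarrow> real" and C u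
    using mult_right_mono[OF that(1)[of u], of "\<bar>k u\<bar>"] that(2)
    by (auto simp: indicator_def abs_mult mult.commute)
  have ki: "integrable lborel (\<lambda>u. C * \<bar>k u\<bar>)" for C
    using k by auto
  have int: "integrable lborel (\<lambda>u. indicator {0..} u *\<^sub>R (k u * W u))" if W: "bounded_cont W" for W
  proof -
    obtain C where C: "C \<ge> 0" "\<And>u. u \<ge> 0 \<Longrightarrow> \<bar>W u\<bar> \<le> C" using W bounded_contE by metis
    show ?thesis
      by (rule Bochner_Integration.integrable_bound[OF ki[of C]])
        (use meas le[of W C] C W in \<open>auto simp: bounded_cont_def\<close>)
  qed
  have "(LINT u:{0..}|lborel. k u * (c * V u + d * W u))
      = c * (LINT u:{0..}|lborel. k u * V u) + d * (LINT u:{0..}|lborel. k u * W u)"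
    if "bounded_cont V" "bounded_cont W" for V W c d
  proof -
    have "(LINT u:{0..}|lborel. k u * (c * V u + d * W u)) = 
      (LINT u|lborel. c * (indicator {0..} u *\<^sub>R (k u * V u)) + d * (indicator {0..} u *\<^sub>R (k u * W u)))"
      unfolding set_lebesgue_integral_def by (intro Bochner_Integration.integral_cong) (auto simp: algebra_simps)
    then show ?thesis
      using int[OF that(1)] int[OF that(2)] by (simp add: set_lebesgue_integral_def)
  qed
  moreover have "(\<lambda>n. LINT u:{0..}|lborel. k u * V n u) \<longlonglongrightarrow> (LINT u:{0..}|lborel. k u * W u)"
    if "\<And>n. continuous_on {0..} (V n)" "continuous_on {0..} W"
      "\<And>n u. u \<ge> 0 \<Longrightarrow> \<bar>V n u\<bar> \<le> C" "\<And>u. u \<ge> 0 \<Longrightarrow> (\<lambda>n. V n u) \<longlonglongrightarrow> W u" for V W C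
    unfolding set_lebesgue_integral_def
  proof (rule integral_dominated_convergence[OF meas meas ki[of C]])
    have "C \<ge> 0" using that(3)[of 0 0] by simp
    then show "AE u in lborel. norm (indicator {0..} u *\<^sub>R (k u * V n u)) \<le> C * \<bar>k u\<bar>" for n
      using le[of "V n" C] that(3) by auto
    show "AE u in lborel. (\<lambda>n. indicator {0..} u *\<^sub>R (k u * V n u)) \<longlonglongrightarrow> indicator {0..} u *\<^sub>R (k u * W u)"
      by (intro AE_I2) (use that(4) in \<open>auto simp: indicator_def intro: tendsto_intros\<close>)
  qed (use that in auto)
  ultimately show ?thesis unfolding normal_functional_def by blast
qed

section \<open>The functional \<open>level\<close> of a Bernstein function\<close>

locale bernstein_triple =
  fixes b :: real and \<nu> :: "real measure" and g :: "real \<Rightarrow> real"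
  assumes b: "b \<ge> 0"
    and sets_nu: "sets \<nu> = sets borel"
    and nu_null: "emeasure \<nu> {..0} = 0"
    and nu_finite: "\<And>K. compact K \<Longrightarrow> K \<subseteq> {0<..} \<Longrightarrow> emeasure \<nu> K < \<infinity>"
    and nu_int: "set_integrable \<nu> {0<..} (\<lambda>s. s / (1 + s))"
    and g: "\<And>z. z > 0 \<Longrightarrow> g z = b * z + (LINT s:{0<..}|\<nu>. 1 - exp (- s * z))"
begin

lemma nu_integrable:
  fixes h :: "real \<Rightarrow> real"
  assumes h: "continuous_on {0<..} h" and le: "\<And>s. s > 0 \<Longrightarrow> \<bar>h s\<bar> \<le> C * (s / (1 + s))"
  shows "set_integrable \<nu> {0<..} h"
  unfolding set_integrable_def
proof (rule Bochner_Integration.integrable_bound)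
  show "integrable \<nu> (\<lambda>s. indicator {0<..} s *\<^sub>R (C * (s / (1 + s))))"
    using set_integrable_mult_right[OF nu_int, of C] by (simp add: set_integrable_def)
  show "(\<lambda>s. indicator {0<..} s *\<^sub>R h s) \<in> borel_measurable \<nu>"
    using borel_measurable_continuous_on_indicator[OF _ h] measurable_cong_sets[OF sets_nu refl] by auto
  show "AE s in \<nu>. norm (indicator {0<..} s *\<^sub>R h s) \<le> norm (indicator {0<..} s *\<^sub>R (C * (s / (1 + s))))"
  proof (rule AE_I2)
    fix s
    show "norm (indicator {0<..} s *\<^sub>R h s) \<le> norm (indicator {0<..} s *\<^sub>R (C * (s / (1 + s))))"
      using order_trans[OF le[of s] abs_ge_self] by (cases "s > 0") auto
  qed
qed

lemma min_le: "0 < s \<Longrightarrow> 0 \<le> t \<Longrightarrow> min s t \<le> (1 + t) * (s / (1 + s :: real))"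
  by (auto simp: min_def field_simps)

lemma one_minus_exp_le: "0 < s \<Longrightarrow> 0 < z \<Longrightarrow> 1 - exp (- s * z) \<le> (1 + z) * (s / (1 + s :: real))"
proof -
  assume s: "0 < s" "0 < z"
  \<comment> \<open>This is \<open>1 - exp (- v) \<le> min v 1\<close> at \<open>v = s * z\<close>,
    with \<open>z\<close> pulled out so that \<open>min_le\<close> applies.\<close>
  have "1 - exp (- s * z) \<le> z * min s (1 / z)"
    using exp_ge_add_one_self[of "- s * z"] s exp_gt_zero[of "- s * z"]
    by (auto simp: min_def mult.commute simp del: exp_gt_zero)
  also have "\<dots> \<le> z * ((1 + 1 / z) * (s / (1 + s)))"
    using s by (intro mult_left_mono min_le) auto
  also have "\<dots> = (z * (1 + 1 / z)) * (s / (1 + s))" by (simp only: mult.assoc)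
  also have "z * (1 + 1 / z) = 1 + z" using s by (simp add: field_simps)
  finally show ?thesis .
qed

lemma one_minus_exp_integrable: "z > 0 \<Longrightarrow> set_integrable \<nu> {0<..} (\<lambda>s. 1 - exp (- s * z))"
  using one_minus_exp_le by (intro nu_integrable[of _ "1 + z"] continuous_intros) auto

text \<open>\<open>level t\<close> is integration against the bounded signed measure with Laplace transform
  \<open>g z * (1 - exp (- z * t)) / z\<close>, that is, \<open>t * g(A) * C\<^sub>t(A)\<close> on orbits.\<close>

definition level :: "real \<Rightarrow> (real \<Rightarrow> real) \<Rightarrow> real" where
  "level t W = b * (W 0 - W t) + (LINT s:{0<..}|\<nu>. primitive W s + primitive W t - primitive W (s + t))"

lemma level_cong:
  assumes t: "t \<ge> 0" and eq: "\<And>u. u \<ge> 0 \<Longrightarrow> V u = W u"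
  shows "level t V = level t W"
proof -
  have "primitive V v = primitive W v" for v
    unfolding primitive_def by (rule Henstock_Kurzweil_Integration.integral_cong) (use eq in auto)
  then show ?thesis using eq t by (simp add: level_def)
qed

text \<open>Since \<open>primitive W 0 = 0\<close>, the expression is a difference of two increments
  of length \<open>s\<close>, and equally of two increments of length \<open>t\<close>. Either
  reading gives a Lipschitz bound, hence the minimum.\<close>

lemma primitive_second_difference:
  assumes W: "continuous_on {0..} W" "\<And>u. u \<ge> 0 \<Longrightarrow> \<bar>W u\<bar> \<le> C" and st: "s \<ge> 0" "t \<ge> 0"
  shows "\<bar>primitive W s + primitive W t - primitive W (s + t)\<bar> \<le> 2 * C * min s t"
proof -
  have C: "C \<ge> 0" using W(2)[of 0] by simp
  have 0: "primitive W 0 = 0" by (simp add: primitive_def)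
  have "\<bar>primitive W s + primitive W t - primitive W (s + t)\<bar> \<le> 2 * C * s"
    using primitive_lipschitz[OF W, of 0 s] primitive_lipschitz[OF W, of t "s + t"] st 0 by simp
  moreover have "\<bar>primitive W s + primitive W t - primitive W (s + t)\<bar> \<le> 2 * C * t"
    using primitive_lipschitz[OF W, of 0 t] primitive_lipschitz[OF W, of s "s + t"] st 0 by simp
  ultimately show ?thesis by (simp add: min_def)
qed

lemma second_difference_continuous:
  assumes "bounded_cont W" "t \<ge> 0"
  shows "continuous_on {0<..} (\<lambda>s. primitive W s + primitive W t - primitive W (s + t))"
  by (intro continuous_intros continuous_on_compose2[OF primitive_continuous[OF assms(1)]]) (use assms in auto)

lemma second_difference_bound:
  assumes W: "continuous_on {0..} W" "\<And>u. u \<ge> 0 \<Longrightarrow> \<bar>W u\<bar> \<le> C" and st: "s > 0" "t \<ge> 0"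
  shows "\<bar>primitive W s + primitive W t - primitive W (s + t)\<bar> \<le> 2 * C * (1 + t) * (s / (1 + s))"
proof -
  have C: "C \<ge> 0" using W(2)[of 0] by simp
  show ?thesis
    using primitive_second_difference[OF W, of s t] st mult_left_mono[OF min_le[OF st], of "2 * C"] C
    by (simp add: mult.assoc)
qed

lemma second_difference_integrable:
  assumes W: "bounded_cont W" and t: "t \<ge> 0"
  shows "set_integrable \<nu> {0<..} (\<lambda>s. primitive W s + primitive W t - primitive W (s + t))"
proof -
  obtain C where C: "\<And>u. u \<ge> 0 \<Longrightarrow> \<bar>W u\<bar> \<le> C" using W bounded_contE by metis
  show ?thesis
    using W second_difference_bound[of W C] C t second_difference_continuous[OF W t]
    by (intro nu_integrable[of _ "2 * C * (1 + t)"]) (auto simp: bounded_cont_def)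
qed

lemma normal_functional_level:
  assumes t: "t \<ge> 0"
  shows "normal_functional (level t)"
  unfolding normal_functional_def
proof (intro conjI allI impI)
  fix V W :: "real \<Rightarrow> real" and c d
  assume VW: "bounded_cont V" "bounded_cont W"
  let ?D = "\<lambda>W s. primitive W s + primitive W t - primitive W (s + t)"
  have "(LINT s:{0<..}|\<nu>. ?D (\<lambda>u. c * V u + d * W u) s) = (LINT s:{0<..}|\<nu>. c * ?D V s + d * ?D W s)"
    by (simp add: primitive_lincomb[OF VW] algebra_simps)
  also have "\<dots> = c * (LINT s:{0<..}|\<nu>. ?D V s) + d * (LINT s:{0<..}|\<nu>. ?D W s)"
    using set_integral_add(2)[OF set_integrable_mult_right[OF second_difference_integrable[OF VW(1) t], of c]
        set_integrable_mult_right[OF second_difference_integrable[OF VW(2) t], of d]] by simp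
  finally show "level t (\<lambda>u. c * V u + d * W u) = c * level t V + d * level t W"
    by (simp add: level_def algebra_simps)
next
  fix V :: "nat \<Rightarrow> real \<Rightarrow> real" and W C
  assume V: "\<forall>n. continuous_on {0..} (V n)" and W: "continuous_on {0..} W"
    and C: "\<forall>n. \<forall>u\<ge>0. \<bar>V n u\<bar> \<le> C" and lim: "\<forall>u\<ge>0. (\<lambda>n. V n u) \<longlonglongrightarrow> W u"
  have Wle: "\<bar>W u\<bar> \<le> C" if "u \<ge> 0" for u
    using LIMSEQ_le_const2[OF tendsto_rabs[OF lim[rule_format, OF that]], of C] C that by auto
  have bW: "bounded_cont W" and bV: "bounded_cont (V n)" for n
    using V W C Wle by (auto simp: bounded_cont_def)
  have plim: "(\<lambda>n. primitive (V n) v) \<longlonglongrightarrow> primitive W v" for v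
    using V W C lim by (intro primitive_tendsto) auto
  let ?D = "\<lambda>W s. primitive W s + primitive W t - primitive W (s + t)"
  have "(\<lambda>n. LINT s:{0<..}|\<nu>. ?D (V n) s) \<longlonglongrightarrow> (LINT s:{0<..}|\<nu>. ?D W s)"
    unfolding set_lebesgue_integral_def
  proof (rule integral_dominated_convergence)
    show "(\<lambda>s. indicator {0<..} s *\<^sub>R ?D W s) \<in> borel_measurable \<nu>"
      using second_difference_integrable[OF bW t] by (auto simp: set_integrable_def)
    show "(\<lambda>s. indicator {0<..} s *\<^sub>R ?D (V n) s) \<in> borel_measurable \<nu>" for n
      using second_difference_integrable[OF bV t] by (auto simp: set_integrable_def)
    show "integrable \<nu> (\<lambda>s. indicator {0<..} s *\<^sub>R (2 * C * (1 + t) * (s / (1 + s))))"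
      using set_integrable_mult_right[OF nu_int, of "2 * C * (1 + t)"] by (simp add: set_integrable_def)
    show "AE s in \<nu>. norm (indicator {0<..} s *\<^sub>R ?D (V n) s) \<le> indicator {0<..} s *\<^sub>R (2 * C * (1 + t) * (s / (1 + s)))" for n
      using second_difference_bound[of "V n" C] V C t by (intro AE_I2) (auto simp: indicator_def)
    show "AE s in \<nu>. (\<lambda>n. indicator {0<..} s *\<^sub>R ?D (V n) s) \<longlonglongrightarrow> indicator {0<..} s *\<^sub>R ?D W s"
      by (intro AE_I2 tendsto_intros plim)
  qed
  then show "(\<lambda>n. level t (V n)) \<longlonglongrightarrow> level t W"
    unfolding level_def using lim t by (intro tendsto_intros) auto
qed

text \<open>For an exponential the second difference factorises into
  \<open>(1 - exp (- s * z)) * (1 - exp (- z * t)) / z\<close>. Integration over \<open>s\<close>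
  then reproduces the integral part of \<open>g\<close>, and the boundary term supplies
  \<open>b * z\<close>.\<close>

lemma level_exp:
  assumes z: "z > 0" and t: "t \<ge> 0"
  shows "level t (\<lambda>u. exp (- z * u)) = g z * primitive (\<lambda>u. exp (- z * u)) t"
proof -
  have "(LINT s:{0<..}|\<nu>. primitive (\<lambda>u. exp (- z * u)) s + primitive (\<lambda>u. exp (- z * u)) t - primitive (\<lambda>u. exp (- z * u)) (s + t))
      = (LINT s:{0<..}|\<nu>. (1 - exp (- z * t)) / z * (1 - exp (- s * z)))"
  proof (rule set_lebesgue_integral_cong)
    show "\<forall>s. s \<in> {0<..} \<longrightarrow> primitive (\<lambda>u. exp (- z * u)) s + primitive (\<lambda>u. exp (- z * u)) t - primitive (\<lambda>u. exp (- z * u)) (s + t)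
        = (1 - exp (- z * t)) / z * (1 - exp (- s * z))"
    proof (intro allI impI)
      fix s :: real assume s: "s \<in> {0<..}"
      have p: "primitive (\<lambda>u. exp (- z * u)) s = (1 - exp (- z * s)) / z"
        "primitive (\<lambda>u. exp (- z * u)) t = (1 - exp (- z * t)) / z"
        "primitive (\<lambda>u. exp (- z * u)) (s + t) = (1 - exp (- z * (s + t))) / z"
        using s t primitive_exp[OF z, of s] primitive_exp[OF z, of t] primitive_exp[OF z, of "s + t"] by auto
      have sz: "- s * z = - z * s" by simp
      have e: "exp (- z * (s + t)) = exp (- s * z) * exp (- z * t)"
        by (simp add: algebra_simps flip: exp_add)
      have "primitive (\<lambda>u. exp (- z * u)) s + primitive (\<lambda>u. exp (- z * u)) t - primitive (\<lambda>u. exp (- z * u)) (s + t)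
        = ((1 - exp (- s * z)) + (1 - exp (- z * t)) - (1 - exp (- z * (s + t)))) / z"
        unfolding p sz by (simp add: add_divide_distrib diff_divide_distrib)
      then show "primitive (\<lambda>u. exp (- z * u)) s + primitive (\<lambda>u. exp (- z * u)) t - primitive (\<lambda>u. exp (- z * u)) (s + t)
        = (1 - exp (- z * t)) / z * (1 - exp (- s * z))"
        unfolding e by (simp add: algebra_simps)
    qed
  qed (simp add: sets_nu)
  also have "\<dots> = (1 - exp (- z * t)) / z * (LINT s:{0<..}|\<nu>. 1 - exp (- s * z))"
    by (rule set_integral_mult_right)
  finally show ?thesis
    unfolding level_def g[OF z] primitive_exp[OF z t] using z by (simp add: field_simps)
qed

lemma level_bound:
  assumes W: "continuous_on {0..} W" "\<And>u. u \<ge> 0 \<Longrightarrow> \<bar>W u\<bar> \<le> C" and t: "t > 0"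
  shows "\<bar>level t W\<bar> \<le> 4 * C * (t * g (1 / t))"
proof -
  have C: "C \<ge> 0" using W(2)[of 0] by simp
  have bW: "bounded_cont W" using W by (auto simp: bounded_cont_def)
  let ?D = "\<lambda>s. primitive W s + primitive W t - primitive W (s + t)"
  \<comment> \<open>From \<open>exp v \<ge> 1 + v\<close> at \<open>v = s / t\<close> one gets
    \<open>1 - exp (- s / t) \<ge> s / (s + t)\<close>. The harmonic mean
    \<open>2 * s * t / (s + t)\<close> dominates \<open>min s t\<close>, which explains the second
    factor \<open>2\<close>.\<close>
  have D: "\<bar>?D s\<bar> \<le> 4 * C * t * (1 - exp (- s * (1 / t)))" if "s > 0" for s
  proof -
    have "exp (- s * (1 / t)) * (1 + s / t) \<le> exp (- s * (1 / t)) * exp (s / t)"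
      by (intro mult_left_mono exp_ge_add_one_self) auto
    then have "exp (- s * (1 / t)) * (1 + s / t) \<le> 1" by (simp flip: exp_add)
    then have "exp (- s * (1 / t)) \<le> t / (t + s)"
      using that t by (simp add: field_simps)
    then have "2 * t * (s / (t + s)) \<le> 2 * t * (1 - exp (- s * (1 / t)))"
      using that t by (intro mult_left_mono) (auto simp: field_simps)
    moreover have "min s t \<le> 2 * t * (s / (t + s))"
      using that t by (auto simp: min_def field_simps)
    ultimately have "min s t \<le> 2 * t * (1 - exp (- s * (1 / t)))" by linarith
    from mult_left_mono[OF this, of "2 * C"] show ?thesis
      using primitive_second_difference[OF W, of s t] that t C by (simp add: algebra_simps)
  qed
  have i: "set_integrable \<nu> {0<..} ?D" using second_difference_integrable[OF bW] t by simp
  have "\<bar>LINT s:{0<..}|\<nu>. ?D s\<bar> \<le> (LINT s:{0<..}|\<nu>. \<bar>?D s\<bar>)"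
    using set_integral_norm_bound[OF i] by simp
  also have "\<dots> \<le> (LINT s:{0<..}|\<nu>. 4 * C * t * (1 - exp (- s * (1 / t))))"
    using D t by (intro set_integral_mono set_integrable_abs i set_integrable_mult_right one_minus_exp_integrable) auto
  also have "\<dots> = 4 * C * t * (LINT s:{0<..}|\<nu>. 1 - exp (- s * (1 / t)))" by simp
  finally have 1: "\<bar>LINT s:{0<..}|\<nu>. ?D s\<bar> \<le> 4 * C * t * (LINT s:{0<..}|\<nu>. 1 - exp (- s * (1 / t)))" .
  \<comment> \<open>The drift contributes exactly \<open>b\<close> to \<open>t * g (1 / t)\<close>,
    so the boundary term fits under the same constant.\<close>
  have "\<bar>W 0 - W t\<bar> \<le> 4 * C" using W(2)[of 0] W(2)[of t] C t by linarith
  then have "\<bar>b * (W 0 - W t)\<bar> \<le> b * (4 * C)" using b by (simp add: abs_mult mult_left_mono)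
  moreover have "4 * C * (t * g (1 / t)) = b * (4 * C) + 4 * C * t * (LINT s:{0<..}|\<nu>. 1 - exp (- s * (1 / t)))"
    using t g[of "1 / t"] by (simp add: algebra_simps)
  ultimately show ?thesis using 1 unfolding level_def by linarith
qed

text \<open>By \<open>primitive_shift\<close> the primitive of \<open>W u - W (u + r)\<close> is a
  second difference in \<open>r\<close>, so the integrand becomes a third mixed difference of
  \<open>primitive W\<close>, symmetric in \<open>r\<close>, \<open>s\<close> and \<open>t\<close>.
  The boundary term is \<open>b\<close> times a mixed difference of \<open>W\<close> in
  \<open>r\<close> and \<open>t\<close>.\<close>

lemma level_swap:
  assumes W: "continuous_on {0..} W" and rt: "r \<ge> 0" "t \<ge> 0"
  shows "level t (\<lambda>u. W u - W (u + r)) = level r (\<lambda>u. W u - W (u + t))"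
proof -
  have "(LINT s:{0<..}|\<nu>. primitive (\<lambda>u. W u - W (u + r)) s + primitive (\<lambda>u. W u - W (u + r)) t - primitive (\<lambda>u. W u - W (u + r)) (s + t))
    = (LINT s:{0<..}|\<nu>. primitive (\<lambda>u. W u - W (u + t)) s + primitive (\<lambda>u. W u - W (u + t)) r - primitive (\<lambda>u. W u - W (u + t)) (s + r))"
    using rt sets_nu by (intro set_lebesgue_integral_cong) (auto simp: primitive_shift[OF W] add_ac)
  then show ?thesis by (simp add: level_def add.commute)
qed

end

subsection \<open>The regulariser\<close>

text \<open>The density of the regulariser, extended by \<open>0\<close> to negative arguments so
  that its translate by \<open>s\<close> is simply \<open>ramp (u - s)\<close>.\<close>

definition ramp :: "real \<Rightarrow> real" where
  "ramp u = max 0 u * exp (- u)"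

lemma continuous_on_ramp [continuous_intros]:
  "continuous_on S f \<Longrightarrow> continuous_on S (\<lambda>x. ramp (f x))"
  unfolding ramp_def by (intro continuous_intros)

lemma ramp_nonneg: "ramp u \<ge> 0"
  by (simp add: ramp_def)

lemma ramp_le: "s \<ge> 0 \<Longrightarrow> ramp s \<le> 2 * exp (- (s / 2))"
proof -
  assume s: "s \<ge> 0"
  have "s / 2 \<le> exp (s / 2)" using exp_ge_add_one_self[of "s / 2"] by linarith
  then have "s * exp (- s) \<le> 2 * exp (s / 2) * exp (- s)" by (intro mult_right_mono) auto
  also have "\<dots> = 2 * exp (- (s / 2))" by (simp flip: exp_add)
  finally show ?thesis using s by (simp add: ramp_def)
qed

lemma ramp_measurable [measurable]: "ramp \<in> borel_measurable borel"
  by (intro borel_measurable_continuous_onI continuous_on_ramp continuous_on_id)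

lemma has_bochner_integral_exp:
  fixes c :: real
  assumes "c > 0"
  shows "has_bochner_integral lborel (\<lambda>u. indicator {0..} u * exp (- c * u)) (1 / c)"
proof (rule has_bochner_integral_nn_integral)
  have "(\<integral>\<^sup>+u. ennreal (indicator {0..} u * exp (- c * u)) \<partial>lborel)
      = (\<integral>\<^sup>+u. ennreal (exp (- c * u)) * indicator {0..} u \<partial>lborel)"
    by (intro nn_integral_cong) (auto simp: indicator_def)
  also have "\<dots> = 0 - (- exp (- c * 0) / c)"
  proof (rule nn_integral_FTC_atLeast)
    have "((\<lambda>u. - exp (- c * u) / c) \<longlongrightarrow> - 0 / c) at_top"
      using assms by (intro tendsto_intros filterlim_compose[OF exp_at_bot]
          filterlim_tendsto_neg_mult_at_bot[OF tendsto_const]) (auto simp: filterlim_ident)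
    then show "((\<lambda>u. - exp (- c * u) / c) \<longlongrightarrow> 0) at_top" by simp
  qed (use assms in \<open>auto intro!: derivative_eq_intros\<close>)
  finally show "(\<integral>\<^sup>+u. ennreal (indicator {0..} u * exp (- c * u)) \<partial>lborel) = ennreal (1 / c)" by simp
qed (use assms in auto)

lemma has_bochner_integral_ramp:
  fixes c :: real
  assumes c: "c > 0"
  shows "has_bochner_integral lborel (\<lambda>u. max 0 u * exp (- c * u)) (1 / c\<^sup>2)"
proof (rule has_bochner_integral_nn_integral)
  have "(\<integral>\<^sup>+u. ennreal (max 0 u * exp (- c * u)) \<partial>lborel)
      = (\<integral>\<^sup>+u. ennreal (u * exp (- c * u)) * indicator {0..} u \<partial>lborel)"
    by (intro nn_integral_cong) (auto simp: indicator_def max_def)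
  also have "\<dots> = 0 - (- (c * 0 + 1) * exp (- c * 0) / c\<^sup>2)"
  proof (rule nn_integral_FTC_atLeast)
    show "((\<lambda>u. - (c * u + 1) * exp (- c * u) / c\<^sup>2) \<longlongrightarrow> 0) at_top"
    proof -
      have l: "filterlim (\<lambda>u. c * u) at_top at_top"
        using c by (intro filterlim_tendsto_pos_mult_at_top[OF tendsto_const _ filterlim_ident])
      have "((\<lambda>v :: real. v ^ 1 / exp v + v ^ 0 / exp v) \<longlongrightarrow> 0 + 0) at_top"
        by (intro tendsto_add tendsto_power_div_exp_0)
      then have "((\<lambda>u. (c * u) ^ 1 / exp (c * u) + (c * u) ^ 0 / exp (c * u)) \<longlongrightarrow> 0 + 0) at_top"
        by (rule filterlim_compose) (rule l)
      from tendsto_mult_left[OF this, of "- (1 / c\<^sup>2)"]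
      have "((\<lambda>u. - (1 / c\<^sup>2) * ((c * u) ^ 1 / exp (c * u) + (c * u) ^ 0 / exp (c * u))) \<longlongrightarrow> 0) at_top" by simp
      also have "(\<lambda>u. - (1 / c\<^sup>2) * ((c * u) ^ 1 / exp (c * u) + (c * u) ^ 0 / exp (c * u)))
          = (\<lambda>u. - (c * u + 1) * exp (- c * u) / c\<^sup>2)"
        by (auto simp: exp_minus divide_inverse algebra_simps)
      finally show ?thesis .
    qed
    show "((\<lambda>u. - (c * u + 1) * exp (- c * u) / c\<^sup>2) has_real_derivative u * exp (- c * u)) (at u)" for u
      using c by (auto intro!: derivative_eq_intros simp: field_simps power2_eq_square)
  qed auto
  finally show "(\<integral>\<^sup>+u. ennreal (max 0 u * exp (- c * u)) \<partial>lborel) = ennreal (1 / c\<^sup>2)" by simp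
qed auto

lemma has_bochner_integral_ramp_shift:
  fixes s z :: real
  assumes z: "z \<ge> 0"
  shows "has_bochner_integral lborel (\<lambda>u. ramp (u - s) * exp (- z * u)) (exp (- s * z) / (1 + z)\<^sup>2)"
proof -
  have "has_bochner_integral lborel (\<lambda>v. max 0 v * exp (- (1 + z) * v)) (1 / (1 + z)\<^sup>2)"
    using z by (intro has_bochner_integral_ramp) simp
  then have "has_bochner_integral lborel (\<lambda>u. max 0 (- s + 1 * u) * exp (- (1 + z) * (- s + 1 * u))) (1 / (1 + z)\<^sup>2 /\<^sub>R \<bar>1\<bar>)"
    by (rule lborel_has_bochner_integral_real_affine_iff[THEN iffD1, rotated]) simp
  then have "has_bochner_integral lborel (\<lambda>u. exp (- s * z) * (max 0 (- s + 1 * u) * exp (- (1 + z) * (- s + 1 * u)))) (exp (- s * z) * (1 / (1 + z)\<^sup>2 /\<^sub>R \<bar>1\<bar>))"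
    by (rule has_bochner_integral_mult_right)
  moreover have "exp (- s * z) * (max 0 (- s + 1 * u) * exp (- (1 + z) * (- s + 1 * u))) = ramp (u - s) * exp (- z * u)" for u
  proof -
    have "exp (- s * z) * exp (- (1 + z) * (- s + 1 * u)) = exp (- (u - s)) * exp (- z * u)"
      by (simp add: algebra_simps flip: exp_add)
    then show ?thesis unfolding ramp_def by (simp del: mult_minus_left)
  qed
  ultimately show ?thesis by simp
qed

lemma ramp_integrable: "integrable lborel ramp"
  using has_bochner_integral_ramp_shift[of 0 0] by (simp add: has_bochner_integral_iff)

text \<open>For \<open>u \<ge> s\<close> the difference equals
  \<open>s * exp (- u) - (1 - exp (- s)) * ramp (u - s)\<close>. Each of the two parts has integral
  at most \<open>s\<close>, which is the smallness needed for short translations.\<close>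

lemma ramp_diff_le:
  assumes s: "s > 0"
  shows "\<bar>ramp u - ramp (u - s)\<bar> \<le> s * (indicator {0..} u * exp (- u)) + (1 - exp (- s)) * ramp (u - s)"
proof (cases "u < s")
  case True
  then show ?thesis using s by (auto simp: ramp_def max_def mult_right_mono indicator_def)
next
  case False
  have "exp (- u) = exp (- s) * exp (- (u - s))" by (simp flip: exp_add)
  then have "ramp u - ramp (u - s) = s * exp (- u) - (1 - exp (- s)) * ramp (u - s)"
    using False s by (simp add: ramp_def max_def algebra_simps)
  moreover have "0 \<le> s * exp (- u)" "0 \<le> (1 - exp (- s)) * ramp (u - s)"
    using s ramp_nonneg[of "u - s"] by auto
  ultimately show ?thesis using False s by (simp add: abs_le_iff)
qed

text \<open>The comparison with \<open>s / (1 + s)\<close> matches the integrability condition on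
  \<nu>. Short translations are handled by the linear bound \<open>2 * s\<close>, long ones by the
  total mass \<open>2\<close> of the two bumps; each is at most \<open>4 * (s / (1 + s))\<close> in
  its range.\<close>

lemma ramp_diff_integral_le:
  assumes s: "s > 0"
  shows "(LINT u|lborel. \<bar>ramp u - ramp (u - s)\<bar>) \<le> 4 * (s / (1 + s))"
proof -
  have 0: "has_bochner_integral lborel (\<lambda>u. ramp (u - s)) 1" for s
    using has_bochner_integral_ramp_shift[of 0 s] by simp
  have 1: "has_bochner_integral lborel ramp 1" using 0[of 0] by simp
  have i: "integrable lborel (\<lambda>u. \<bar>ramp u - ramp (u - s)\<bar>)"
    using 0[of s] 1 by (auto simp: has_bochner_integral_iff)
  show ?thesis
  proof (cases "s \<le> 1")
    case True
    have h: "has_bochner_integral lborel (\<lambda>u. s * (indicator {0..} u * exp (- u)) + (1 - exp (- s)) * ramp (u - s))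
        (s * 1 + (1 - exp (- s)) * 1)"
      using has_bochner_integral_exp[of 1] 0[of s]
      by (intro has_bochner_integral_add has_bochner_integral_mult_right) auto
    have "(LINT u|lborel. \<bar>ramp u - ramp (u - s)\<bar>)
        \<le> (LINT u|lborel. s * (indicator {0..} u * exp (- u)) + (1 - exp (- s)) * ramp (u - s))"
      using h i ramp_diff_le[OF s] by (intro integral_mono) (auto simp: has_bochner_integral_iff)
    also have "\<dots> = s + (1 - exp (- s))" using has_bochner_integral_integral_eq[OF h] by simp
    also have "\<dots> \<le> 2 * s" using exp_ge_add_one_self[of "- s"] by simp
    also have "\<dots> \<le> 4 * (s / (1 + s))" using s True by (simp add: field_simps mult_left_mono)
    finally show ?thesis .
  next
    case False
    have h: "has_bochner_integral lborel (\<lambda>u. ramp u + ramp (u - s)) (1 + 1)"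
      by (intro has_bochner_integral_add 0 1)
    have "(LINT u|lborel. \<bar>ramp u - ramp (u - s)\<bar>) \<le> (LINT u|lborel. ramp u + ramp (u - s))"
    proof (rule integral_mono[OF i])
      show "\<bar>ramp u - ramp (u - s)\<bar> \<le> ramp u + ramp (u - s)" for u
        using ramp_nonneg[of u] ramp_nonneg[of "u - s"] by linarith
    qed (use h in \<open>simp add: has_bochner_integral_iff\<close>)
    also have "\<dots> = 2" using has_bochner_integral_integral_eq[OF h] by simp
    also have "\<dots> \<le> 4 * (s / (1 + s))" using s False by (simp add: field_simps)
    finally show ?thesis .
  qed
qed

lemma lint_Rplus_eq:
  fixes h :: "real \<Rightarrow> real"
  assumes "\<And>u. u < 0 \<Longrightarrow> h u = 0"
  shows "(LINT u:{0..}|M. h u) = (LINT u|M. h u)"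
  unfolding set_lebesgue_integral_def using assms
  by (intro Bochner_Integration.integral_cong) (auto simp: indicator_def not_le)

lemma ramp_laplace:
  assumes "z > 0"
  shows "(LINT u:{0..}|lborel. ramp u * exp (- z * u)) = 1 / (1 + z)\<^sup>2"
proof -
  have "(LINT u:{0..}|lborel. ramp u * exp (- z * u)) = (LINT u|lborel. ramp u * exp (- z * u))"
    by (rule lint_Rplus_eq) (simp add: ramp_def)
  then show ?thesis
    using has_bochner_integral_integral_eq[OF has_bochner_integral_ramp_shift[of z 0]] assms by simp
qed

section \<open>The density of the regularised Bernstein function\<close>

context bernstein_triple
begin

text \<open>Fubini's theorem for \<open>kernel\<close> requires this. The null set
  \<open>{..0}\<close> and the compact intervals exhausting the open half-line form the
  cover.\<close>

lemma sigma_finite_nu: "sigma_finite_measure \<nu>"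
proof
  let ?A = "insert {..0} (range (\<lambda>n. {inverse (real (Suc n))..real (Suc n)}))"
  have "x \<in> \<Union>?A" for x :: real
  proof (cases "x \<le> 0")
    case False
    then have x: "x > 0" by simp
    obtain m where m: "inverse (real (Suc m)) < x" using reals_Archimedean[OF x] by auto
    obtain n where n: "x \<le> real n" using real_arch_simple by blast
    have "inverse (real (Suc (max m n))) \<le> inverse (real (Suc m))" by (intro le_imp_inverse_le) auto
    then have "inverse (real (Suc (max m n))) \<le> x" using m by linarith
    moreover have "x \<le> real (Suc (max m n))" using n by simp
    ultimately have "x \<in> {inverse (real (Suc (max m n)))..real (Suc (max m n))}"
      unfolding atLeastAtMost_iff by blast
    then show ?thesis by blast
  qed auto
  then have "\<Union>?A = UNIV" by blast
  then have "\<Union>?A = space \<nu>" using sets_eq_imp_space_eq[OF sets_nu] by simp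
  moreover have "emeasure \<nu> a \<noteq> \<infinity>" if "a \<in> ?A" for a
    using that
  proof (elim insertE imageE)
    fix n assume a: "a = {inverse (real (Suc n))..real (Suc n)}"
    have "{inverse (real (Suc n))..real (Suc n)} \<subseteq> {0<..}"
    proof
      fix x assume "x \<in> {inverse (real (Suc n))..real (Suc n)}"
      moreover have "0 < inverse (real (Suc n))" by simp
      ultimately show "x \<in> {0<..}" unfolding atLeastAtMost_iff greaterThan_iff by linarith
    qed
    then show "emeasure \<nu> a \<noteq> \<infinity>" using nu_finite[of a] a by auto
  qed (simp add: nu_null)
  ultimately show "\<exists>A. countable A \<and> A \<subseteq> sets \<nu> \<and> \<Union>A = space \<nu> \<and> (\<forall>a\<in>A. emeasure \<nu> a \<noteq> \<infinity>)"
    by (intro exI[of _ ?A]) (auto simp: sets_nu)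
qed

text \<open>The density of the bounded signed measure with Laplace transform \<open>g z / (1 + z)\<^sup>2\<close>.\<close>

definition kernel :: "real \<Rightarrow> real" where
  "kernel u = b * (indicator {0..} u * exp (- u) - ramp u)
     + (LINT s|\<nu>. indicator {0<..} s * (ramp u - ramp (u - s)))"

lemma kernel_neg: "u < 0 \<Longrightarrow> kernel u = 0"
proof -
  assume u: "u < 0"
  then have "(LINT s|\<nu>. indicator {0<..} s * (ramp u - ramp (u - s))) = (LINT s|\<nu>. 0)"
    by (intro Bochner_Integration.integral_cong) (auto simp: indicator_def ramp_def)
  then show ?thesis using u by (simp add: kernel_def ramp_def)
qed

text \<open>Exchanging the integrals over \<open>s\<close> and \<open>u\<close> lets each
  translation contribute \<open>(1 - exp (- s * z)) / (1 + z)\<^sup>2\<close>. The case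
  \<open>z = 0\<close> is included for the integrability of \<open>kernel\<close> itself; the
  right-hand side is spelled out because \<open>g\<close> is prescribed only for
  \<open>z > 0\<close>.\<close>

lemma kernel_transform:
  assumes z: "z \<ge> 0"
  shows "integrable lborel (\<lambda>u. kernel u * exp (- z * u))"
    and "(LINT u|lborel. kernel u * exp (- z * u))
      = (b * z + (LINT s:{0<..}|\<nu>. 1 - exp (- s * z))) / (1 + z)\<^sup>2"
proof -
  interpret nu: sigma_finite_measure \<nu> by (rule sigma_finite_nu)
  interpret pair_sigma_finite \<nu> lborel ..
  note [measurable_cong] = sets_nu
  define f where "f z = (\<lambda>(s, u). indicator {0<..} s * (ramp u - ramp (u - s)) * exp (- z * u))" for z
  have fm [measurable]: "f z \<in> borel_measurable (\<nu> \<Otimes>\<^sub>M lborel)" for z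
    unfolding f_def by measurable
  have fi: "has_bochner_integral lborel (\<lambda>u. f z (s, u)) (indicator {0<..} s * (1 - exp (- s * z)) / (1 + z)\<^sup>2)"
    if "z \<ge> 0" for z s
  proof -
    have "has_bochner_integral lborel (\<lambda>u. indicator {0<..} s * (ramp (u - 0) * exp (- z * u) - ramp (u - s) * exp (- z * u)))
        (indicator {0<..} s * (exp (- 0 * z) / (1 + z)\<^sup>2 - exp (- s * z) / (1 + z)\<^sup>2))"
      by (intro has_bochner_integral_mult_right has_bochner_integral_diff has_bochner_integral_ramp_shift that)
    then show ?thesis by (simp add: f_def algebra_simps diff_divide_distrib)
  qed
  have f0: "integrable (\<nu> \<Otimes>\<^sub>M lborel) (f 0)"
  proof (rule Fubini_integrable[OF fm])
    show "AE s in \<nu>. integrable lborel (\<lambda>u. f 0 (s, u))"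
      using fi[of 0] by (auto simp: has_bochner_integral_iff)
    show "integrable \<nu> (\<lambda>s. LINT u|lborel. norm (f 0 (s, u)))"
    proof (rule Bochner_Integration.integrable_bound)
      show "integrable \<nu> (\<lambda>s. indicator {0<..} s *\<^sub>R (4 * (s / (1 + s))))"
        using set_integrable_mult_right[OF nu_int, of 4] by (simp add: set_integrable_def)
      show "AE s in \<nu>. norm (LINT u|lborel. norm (f 0 (s, u))) \<le> norm (indicator {0<..} s *\<^sub>R (4 * (s / (1 + s))))"
      proof (rule AE_I2)
        fix s
        have "0 \<le> (LINT u|lborel. norm (f 0 (s, u)))" by simp
        moreover have "(LINT u|lborel. norm (f 0 (s, u))) \<le> indicator {0<..} s *\<^sub>R (4 * (s / (1 + s)))"
          using ramp_diff_integral_le[of s] by (cases "s > 0") (auto simp: f_def)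
        ultimately show "norm (LINT u|lborel. norm (f 0 (s, u))) \<le> norm (indicator {0<..} s *\<^sub>R (4 * (s / (1 + s))))"
          unfolding real_norm_def by linarith
      qed
    qed measurable
  qed
  \<comment> \<open>Wherever \<open>f 0\<close> can be nonzero one has \<open>u \<ge> 0\<close>,
    since both bumps vanish for \<open>u < 0 < s\<close>; there the exponential factor is at most
    \<open>1\<close>.\<close>
  have fz: "integrable (\<nu> \<Otimes>\<^sub>M lborel) (f z)"
  proof (rule Bochner_Integration.integrable_bound[OF f0 fm AE_I2])
    fix p :: "real \<times> real"
    obtain s u where p: "p = (s, u)" by (cases p)
    show "norm (f z p) \<le> norm (f 0 p)"
    proof (cases "u < 0 \<or> s \<le> 0")
      case True
      then show ?thesis by (auto simp: p f_def ramp_def max_def indicator_def)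
    next
      case False
      then have "exp (- z * u) \<le> 1" using z by simp
      then show ?thesis by (auto simp: p f_def abs_mult intro!: mult_left_le)
    qed
  qed
  have eq: "kernel u * exp (- z * u) = b * (indicator {0..} u * exp (- (1 + z) * u) - ramp (u - 0) * exp (- z * u))
      + (LINT s|\<nu>. f z (s, u))" for u
  proof -
    have "(LINT s|\<nu>. f z (s, u)) = (LINT s|\<nu>. indicator {0<..} s * (ramp u - ramp (u - s))) * exp (- z * u)"
      unfolding f_def by (simp del: mult_minus_left)
    then show ?thesis by (simp add: kernel_def algebra_simps flip: exp_add)
  qed
  have h1: "has_bochner_integral lborel (\<lambda>u. b * (indicator {0..} u * exp (- (1 + z) * u) - ramp (u - 0) * exp (- z * u)))
      (b * (1 / (1 + z) - exp (- 0 * z) / (1 + z)\<^sup>2))"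
    using z by (intro has_bochner_integral_mult_right has_bochner_integral_diff has_bochner_integral_exp
        has_bochner_integral_ramp_shift) auto
  have i2: "integrable lborel (\<lambda>u. LINT s|\<nu>. f z (s, u))"
    using integrable_snd[of "\<lambda>s u. f z (s, u)"] fz by simp
  show "integrable lborel (\<lambda>u. kernel u * exp (- z * u))"
    unfolding eq using h1 i2 by (intro Bochner_Integration.integrable_add) (simp_all add: has_bochner_integral_iff)
  have "(LINT u|lborel. kernel u * exp (- z * u)) = b * (1 / (1 + z) - exp (- 0 * z) / (1 + z)\<^sup>2)
      + (LINT u|lborel. LINT s|\<nu>. f z (s, u))"
    unfolding eq using h1 i2 by (subst Bochner_Integration.integral_add) (simp_all add: has_bochner_integral_iff)
  also have "(LINT u|lborel. LINT s|\<nu>. f z (s, u)) = (LINT s|\<nu>. LINT u|lborel. f z (s, u))"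
    using Fubini_integral[of "\<lambda>s u. f z (s, u)"] fz by simp
  also have "\<dots> = (LINT s|\<nu>. indicator {0<..} s * (1 - exp (- s * z)) / (1 + z)\<^sup>2)"
    using fi[OF z] by (intro Bochner_Integration.integral_cong refl) (simp add: has_bochner_integral_iff)
  also have "\<dots> = (LINT s:{0<..}|\<nu>. 1 - exp (- s * z)) / (1 + z)\<^sup>2"
    by (simp add: set_lebesgue_integral_def)
  also have "b * (1 / (1 + z) - exp (- 0 * z) / (1 + z)\<^sup>2) = b * z / (1 + z)\<^sup>2"
  proof -
    have "1 / (1 + z) = (1 + z) / (1 + z)\<^sup>2" using z by (simp add: power2_eq_square)
    then show ?thesis by (simp add: diff_divide_distrib[symmetric])
  qed
  finally show "(LINT u|lborel. kernel u * exp (- z * u))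
      = (b * z + (LINT s:{0<..}|\<nu>. 1 - exp (- s * z))) / (1 + z)\<^sup>2"
    by (simp add: add_divide_distrib)
qed

lemma kernel_integrable: "integrable lborel kernel"
  using kernel_transform(1)[of 0] by simp

lemma kernel_laplace:
  assumes "z > 0"
  shows "(LINT u:{0..}|lborel. kernel u * exp (- z * u)) = g z / (1 + z)\<^sup>2"
  using lint_Rplus_eq[of "\<lambda>u. kernel u * exp (- z * u)" lborel] kernel_neg kernel_transform(2)[of z] g[of z] assms
  by simp

end

text \<open>The calculus is formulated with pairs of positive measures. Applied to \<open>k\<close>
  and to \<open>- k\<close>, this gives the positive and the negative part of the signed measure
  with density \<open>k\<close>.\<close>

definition pos_density :: "(real \<Rightarrow> real) \<Rightarrow> real measure" where
  "pos_density k = density lborel (\<lambda>u. ennreal (max 0 (k u)))"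

lemma finite_Rplus_pos_density:
  assumes k: "integrable lborel k" "\<And>u. u < 0 \<Longrightarrow> k u = 0"
  shows "finite_Rplus (pos_density k)"
proof -
  have [measurable]: "k \<in> borel_measurable borel" using k(1) by simp
  have i: "integrable lborel (\<lambda>u. max 0 (k u))" using k(1) by (intro integrable_max) auto
  have "emeasure (pos_density k) (space (pos_density k)) = (\<integral>\<^sup>+u. ennreal (max 0 (k u)) \<partial>lborel)"
    unfolding pos_density_def by (subst emeasure_density) auto
  also have "\<dots> < \<infinity>" using i by (simp add: nn_integral_eq_integral)
  finally have "finite_measure (pos_density k)" by (intro finite_measureI) auto
  moreover have "emeasure (pos_density k) {..<0} = (\<integral>\<^sup>+u. ennreal (max 0 (k u)) * indicator {..<0} u \<partial>lborel)"
    unfolding pos_density_def by (subst emeasure_density) auto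
  moreover have "\<dots> = (\<integral>\<^sup>+u. 0 \<partial>(lborel :: real measure))"
    by (intro nn_integral_cong) (auto simp: k(2) indicator_def)
  ultimately show ?thesis by (simp add: finite_Rplus_def pos_density_def)
qed

lemma pos_density_diff:
  assumes k: "integrable lborel k" and W: "bounded_cont W"
  shows "(LINT s:{0..}|pos_density k. W s) - (LINT s:{0..}|pos_density (\<lambda>u. - k u). W s)
    = (LINT u:{0..}|lborel. k u * W u)"
proof -
  have [measurable]: "k \<in> borel_measurable borel" using k by simp
  have Wc: "continuous_on {0..} W" using W by (simp add: bounded_cont_def)
  obtain C where C: "C \<ge> 0" "\<And>u. u \<ge> 0 \<Longrightarrow> \<bar>W u\<bar> \<le> C" using W bounded_contE by metis
  let ?V = "\<lambda>u. indicator {0..} u *\<^sub>R W u"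
  have [measurable]: "?V \<in> borel_measurable borel"
    by (rule borel_measurable_continuous_on_indicator[OF _ Wc]) simp
  then have [measurable]: "(\<lambda>u. indicator {0..} u * W u) \<in> borel_measurable borel" by simp
  have d: "(LINT s:{0..}|pos_density h. W s) = (LINT u|lborel. max 0 (h u) * ?V u)"
    if [measurable]: "h \<in> borel_measurable borel" for h
    unfolding set_lebesgue_integral_def pos_density_def by (subst integral_density) auto
  have i: "integrable lborel (\<lambda>u. max 0 (h u) * ?V u)" if h: "integrable lborel h" for h
  proof (rule Bochner_Integration.integrable_bound)
    have [measurable]: "h \<in> borel_measurable borel" using h by simp
    show "(\<lambda>u. max 0 (h u) * ?V u) \<in> borel_measurable lborel" by simp
    show "integrable lborel (\<lambda>u. C * h u)" using h by simp
    show "AE u in lborel. norm (max 0 (h u) * ?V u) \<le> norm (C * h u)"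
    proof (rule AE_I2)
      fix u
      have "\<bar>?V u\<bar> \<le> C" using C by (auto simp: indicator_def)
      then have "\<bar>max 0 (h u)\<bar> * \<bar>?V u\<bar> \<le> \<bar>h u\<bar> * C" by (intro mult_mono) auto
      then show "norm (max 0 (h u) * ?V u) \<le> norm (C * h u)" using C by (simp add: abs_mult mult.commute)
    qed
  qed
  have "(LINT s:{0..}|pos_density k. W s) - (LINT s:{0..}|pos_density (\<lambda>u. - k u). W s)
      = (LINT u|lborel. max 0 (k u) * ?V u - max 0 (- k u) * ?V u)"
    using i[of k] i[of "\<lambda>u. - k u"] k by (simp add: d)
  also have "\<dots> = (LINT u:{0..}|lborel. k u * W u)"
    unfolding set_lebesgue_integral_def
    by (intro Bochner_Integration.integral_cong) (auto simp: max_def)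
  finally show ?thesis .
qed

text \<open>The second difference of \<open>r \<mapsto> max 0 (u - r)\<close> is a hat function supported near \<open>0\<close>.\<close>

lemma ramp_average_injective:
  assumes U: "bounded_cont U" and zero: "\<And>r. r \<ge> 0 \<Longrightarrow> (LINT u:{0..}|lborel. ramp u * U (u + r)) = 0"
  shows "U 0 = 0"
proof -
  have Uc: "continuous_on {0..} U" using U by (simp add: bounded_cont_def)
  obtain C where C: "C \<ge> 0" "\<And>u. u \<ge> 0 \<Longrightarrow> \<bar>U u\<bar> \<le> C" using U bounded_contE by metis
  define V where "V u = indicator {0..} u *\<^sub>R U u * exp (- u)" for u
  have [measurable]: "V \<in> borel_measurable borel"
    unfolding V_def by (intro borel_measurable_times borel_measurable_continuous_on_indicator Uc) auto
  \<comment> \<open>Translating the variable by \<open>r\<close> splits off only the factor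
    \<open>exp (- r)\<close>, so the hypothesis says that \<open>V\<close> is orthogonal to every
    \<open>max 0 (u - r)\<close>, and hence to their linear combinations.\<close>
  have A: "has_bochner_integral lborel (\<lambda>u. max 0 (u - r) * V u) 0" if r: "r \<ge> 0" for r
  proof -
    have int: "integrable lborel (\<lambda>u. max 0 (u - r) * V u)"
    proof (rule Bochner_Integration.integrable_bound)
      show "integrable lborel (\<lambda>u. C * ramp u)" using ramp_integrable by simp
      show "AE u in lborel. norm (max 0 (u - r) * V u) \<le> norm (C * ramp u)"
      proof (rule AE_I2)
        fix u
        have "\<bar>indicator {0..} u *\<^sub>R U u\<bar> \<le> C" using C by (auto simp: indicator_def)
        then have "\<bar>max 0 (u - r)\<bar> * \<bar>indicator {0..} u *\<^sub>R U u\<bar> \<le> max 0 u * C"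
          using r by (intro mult_mono) auto
        from mult_right_mono[OF this, of "exp (- u)"]
        show "norm (max 0 (u - r) * V u) \<le> norm (C * ramp u)"
          using C by (simp add: abs_mult V_def ramp_def algebra_simps)
      qed
    qed measurable
    have "(LINT u|lborel. max 0 (u - r) * V u) = (LINT u|lborel. max 0 ((r + 1 * u) - r) * V (r + 1 * u))"
      by (subst lborel_integral_real_affine[of 1 _ r]) auto
    also have "\<dots> = (LINT u|lborel. exp (- r) * (indicator {0..} u *\<^sub>R (ramp u * U (u + r))))"
      using r by (intro Bochner_Integration.integral_cong)
        (auto simp: V_def ramp_def indicator_def max_def algebra_simps exp_add exp_minus exp_diff divide_inverse)
    also have "\<dots> = exp (- r) * (LINT u:{0..}|lborel. ramp u * U (u + r))"
      unfolding set_lebesgue_integral_def by (rule integral_mult_right_zero)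
    finally show ?thesis using int zero[OF r] by (simp add: has_bochner_integral_iff)
  qed
  show ?thesis
  proof (rule ccontr)
    assume U0: "U 0 \<noteq> 0"
    \<comment> \<open>With tolerance \<open>\<bar>U 0\<bar>\<close>, the value \<open>U u\<close>
      keeps the sign of \<open>U 0\<close>.\<close>
    obtain d where d: "d > 0" "\<And>u. u \<ge> 0 \<Longrightarrow> \<bar>u\<bar> < d \<Longrightarrow> \<bar>U u - U 0\<bar> < \<bar>U 0\<bar>"
      using Uc[unfolded continuous_on_iff, rule_format, of 0 "\<bar>U 0\<bar>"] U0 by (auto simp: dist_real_def)
    define h where "h = d / 2"
    \<comment> \<open>The support \<open>[0, 2 * h]\<close> has length \<open>d\<close>. On it
      \<open>U\<close> keeps its sign, so the integrand multiplied by \<open>U 0\<close> is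
      nonnegative and a zero integral makes it vanish almost everywhere.\<close>
    define hat where "hat u = max 0 (u - 0) - 2 * max 0 (u - h) + max 0 (u - 2 * h)" for u :: real
    have h: "h > 0" using d by (simp add: h_def)
    have hat0: "hat u = 0" if "u \<le> 0 \<or> 2 * h \<le> u" for u using that h by (auto simp: hat_def max_def)
    have hatpos: "hat u > 0" if "0 < u" "u < 2 * h" for u using that h by (auto simp: hat_def max_def)
    have Upos: "U 0 * U u > 0" if "0 < u" "u < 2 * h" for u
      using d(2)[of u] that U0 by (auto simp: h_def zero_less_mult_iff)
    have "has_bochner_integral lborel (\<lambda>u. U 0 * (max 0 (u - 0) * V u - 2 * (max 0 (u - h) * V u) + max 0 (u - 2 * h) * V u))
       (U 0 * (0 - 2 * 0 + 0))"
      using h by (intro has_bochner_integral_mult_right has_bochner_integral_add has_bochner_integral_diff A) auto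
    then have hb: "has_bochner_integral lborel (\<lambda>u. U 0 * (hat u * V u)) 0"
      by (simp add: hat_def algebra_simps)
    have nn: "0 \<le> U 0 * (hat u * V u)" and pos: "0 < u \<Longrightarrow> u < 2 * h \<Longrightarrow> U 0 * (hat u * V u) \<noteq> 0" for u
    proof -
      have *: "U 0 * (hat u * V u) > 0" if "0 < u" "u < 2 * h"
      proof -
        have "U 0 * (hat u * V u) = (U 0 * U u) * (hat u * exp (- u))" using that by (simp add: V_def)
        also have "\<dots> > 0" using hatpos[OF that] Upos[OF that] by simp
        finally show ?thesis .
      qed
      then show "0 \<le> U 0 * (hat u * V u)" using hat0[of u] by (cases "0 < u \<and> u < 2 * h") auto
      show "0 < u \<Longrightarrow> u < 2 * h \<Longrightarrow> U 0 * (hat u * V u) \<noteq> 0" using * by (metis less_irrefl)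
    qed
    have "AE u in lborel. U 0 * (hat u * V u) = 0"
      using hb integral_nonneg_eq_0_iff_AE[of lborel "\<lambda>u. U 0 * (hat u * V u)"] nn
      by (auto simp: has_bochner_integral_iff)
    then have "AE u in lborel. u \<notin> {0<..<2 * h}"
      by eventually_elim (use pos in auto)
    then have "emeasure lborel {0<..<2 * h} = 0"
      by (subst (asm) AE_iff_null_sets[symmetric]) (auto simp: null_sets_def)
    then show False using h by simp
  qed
qed

subsection \<open>Orbits of the semigroup\<close>

context
  fixes T :: "real \<Rightarrow> 'a::banach \<Rightarrow> 'a"
  assumes T: "bounded_C0_semigroup T"
begin

lemma semigroup_linear: "s \<ge> 0 \<Longrightarrow> bounded_linear (T s)"
  using T by (simp add: bounded_C0_semigroup_def)

lemma semigroup_zero: "T 0 x = x"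
  using T by (simp add: bounded_C0_semigroup_def)

lemma semigroup_add: "s \<ge> 0 \<Longrightarrow> t \<ge> 0 \<Longrightarrow> T (s + t) x = T s (T t x)"
  using T by (simp add: bounded_C0_semigroup_def)

lemma semigroup_bound:
  obtains M where "M \<ge> 0" "\<And>s x. s \<ge> 0 \<Longrightarrow> norm (T s x) \<le> M * norm x"
proof -
  obtain M where M: "\<And>s. s \<ge> 0 \<Longrightarrow> onorm (T s) \<le> M" using T by (auto simp: bounded_C0_semigroup_def)
  have "norm (T s x) \<le> M * norm x" if "s \<ge> 0" for s x
    using onorm[OF semigroup_linear[OF that], of x] mult_right_mono[OF M[OF that], of "norm x"] by simp
  moreover have "M \<ge> 0" using M[of 0] onorm_pos_le[OF semigroup_linear, of 0] by simp
  ultimately show thesis by (rule that[rotated])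
qed

lemma semigroup_continuous: "continuous_on {0..} (\<lambda>s. T s x)"
  unfolding continuous_on_iff
proof (intro ballI allI impI)
  fix s e :: real assume s: "s \<in> {0..}" and e: "e > 0"
  obtain M where M: "M \<ge> 0" "\<And>s x. s \<ge> 0 \<Longrightarrow> norm (T s x) \<le> M * norm x" using semigroup_bound by metis
  have e': "e / (M + 1) > 0" using e M(1) by simp
  have "((\<lambda>s. T s x) \<longlongrightarrow> x) (at_right 0)" using T by (simp add: bounded_C0_semigroup_def)
  then have "eventually (\<lambda>h. dist (T h x) x < e / (M + 1)) (at_right 0)" using e' by (rule tendstoD)
  then obtain d where d: "d > 0" "\<And>h. 0 < h \<Longrightarrow> h < d \<Longrightarrow> dist (T h x) x < e / (M + 1)"
    by (auto simp: eventually_at_right_field)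
  \<comment> \<open>Both one-sided limits follow from this: the base point \<open>u\<close> is
    \<open>s\<close> for the right limit and the nearby \<open>t < s\<close> for the left one, which
    is why the bound \<open>M\<close> must not depend on \<open>u\<close>. Dividing by
    \<open>M + 1\<close> covers \<open>M = 0\<close>.\<close>
  have *: "dist (T (u + h) x) (T u x) < e" if "u \<ge> 0" "0 \<le> h" "h < d" for u h
  proof (cases "h = 0")
    case False
    then have "norm (T h x - x) < e / (M + 1)" using d(2)[of h] that by (simp add: dist_norm)
    have "T (u + h) x - T u x = T u (T h x - x)"
      using that by (simp add: semigroup_add linear_diff[OF bounded_linear.linear[OF semigroup_linear]])
    then have "norm (T (u + h) x - T u x) \<le> M * norm (T h x - x)" using M(2)[OF that(1)] by simp
    also have "\<dots> \<le> (M + 1) * norm (T h x - x)" by (simp add: mult_right_mono)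
    also have "\<dots> < e" using \<open>norm (T h x - x) < e / (M + 1)\<close> M(1) by (simp add: field_simps)
    finally show ?thesis by (simp add: dist_norm)
  qed (use e in simp)
  show "\<exists>d>0. \<forall>t\<in>{0..}. dist t s < d \<longrightarrow> dist (T t x) (T s x) < e"
  proof (intro exI[of _ d] conjI ballI impI d(1))
    fix t assume t: "t \<in> {0..}" "dist t s < d"
    show "dist (T t x) (T s x) < e"
      using *[of s "t - s"] *[of t "s - t"] s t
      by (cases "s \<le> t") (auto simp: dist_real_def dist_commute)
  qed
qed

lemma functional_semigroup:
  assumes "bounded_linear \<phi>" "r \<ge> 0"
  shows "bounded_linear (\<lambda>u. \<phi> (T r u))"
  by (rule bounded_linear_compose[OF assms(1) semigroup_linear[OF assms(2)]])

lemma orbit_continuous: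
  fixes \<phi> :: "'a \<Rightarrow> real"
  assumes "bounded_linear \<phi>"
  shows "continuous_on {0..} (\<lambda>s. \<phi> (T s x))"
  by (rule bounded_linear.continuous_on[OF assms semigroup_continuous])

lemma orbit_bounded_cont:
  fixes \<phi> :: "'a \<Rightarrow> real"
  assumes \<phi>: "bounded_linear \<phi>"
  shows "bounded_cont (\<lambda>s. \<phi> (T s x))"
proof -
  obtain M where M: "M \<ge> 0" "\<And>s x. s \<ge> 0 \<Longrightarrow> norm (T s x) \<le> M * norm x" using semigroup_bound by metis
  obtain B where B: "B \<ge> 0" "\<And>u. norm (\<phi> u) \<le> norm u * B" using bounded_linear.nonneg_bounded[OF \<phi>] by metis
  show ?thesis
  proof (rule bounded_contI[OF orbit_continuous[OF \<phi>]])
    show "\<bar>\<phi> (T s x)\<bar> \<le> M * norm x * B" if "s \<ge> 0" for s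
      using B(2)[of "T s x"] mult_right_mono[OF M(2)[OF that, of x] B(1)] by simp
  qed
qed

lemma functional_cesaro:
  fixes \<phi> :: "'a \<Rightarrow> real"
  assumes "bounded_linear \<phi>"
  shows "\<phi> (cesaro T t x) = (1 / t) * primitive (\<lambda>s. \<phi> (T s x)) t"
proof -
  have "(\<lambda>s. T s x) integrable_on {0..t}"
    by (rule integrable_continuous_interval, rule continuous_on_subset[OF semigroup_continuous]) auto
  from integral_linear[OF this assms]
  have "\<phi> (integral {0..t} (\<lambda>s. T s x)) = primitive (\<lambda>s. \<phi> (T s x)) t"
    by (simp add: primitive_def comp_def)
  then show ?thesis
    using linear_scale[OF bounded_linear.linear[OF assms]] by (simp add: cesaro_def)
qed

text \<open>The formula for all functionals determines only an element of the bidual; membership in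
  the space itself is obtained from a norm-convergent series of integrals over unit intervals, whose
  terms decay geometrically by \<open>ramp_le\<close>.\<close>

lemma ramp_average_exists:
  obtains w where "\<And>\<phi> :: 'a \<Rightarrow> real. bounded_linear \<phi> \<Longrightarrow> \<phi> w = (LINT s:{0..}|lborel. ramp s * \<phi> (T s x))"
proof -
  obtain M where M: "M \<ge> 0" "\<And>s x. s \<ge> 0 \<Longrightarrow> norm (T s x) \<le> M * norm x" using semigroup_bound by metis
  define F where "F s = ramp s *\<^sub>R T s x" for s
  define v where "v n = integral {real n..real (Suc n)} F" for n
  have Fc: "continuous_on {0..} F"
    unfolding F_def by (intro continuous_intros semigroup_continuous)
  have Fle: "norm (F s) \<le> 2 * exp (- (s / 2)) * (M * norm x)" if "s \<ge> 0" for s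
    unfolding F_def norm_scaleR using ramp_le[OF that] ramp_nonneg[of s] M(2)[OF that]
    by (intro mult_mono) auto
  have "norm (v n) \<le> (2 * (M * norm x)) * exp (- (1 / 2)) ^ n" for n
  proof -
    have "norm (v n) \<le> 2 * exp (- (real n / 2)) * (M * norm x) * (real (Suc n) - real n)"
      unfolding v_def
    proof (rule integral_bound)
      show "continuous_on {real n..real (Suc n)} F" by (rule continuous_on_subset[OF Fc]) auto
      show "norm (F s) \<le> 2 * exp (- (real n / 2)) * (M * norm x)" if s: "s \<in> {real n..real (Suc n)}" for s
      proof -
        have "2 * exp (- (s / 2)) * (M * norm x) \<le> 2 * exp (- (real n / 2)) * (M * norm x)"
          using M(1) s by (intro mult_right_mono) auto
        with Fle[of s] s show ?thesis by auto
      qed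
    qed auto
    then show ?thesis by (simp add: exp_of_nat_mult[symmetric] algebra_simps)
  qed
  moreover have "summable (\<lambda>n. (2 * (M * norm x)) * exp (- (1 / 2 :: real)) ^ n)"
    by (intro summable_mult summable_geometric) auto
  ultimately have sv: "summable v" by (rule summable_comparison_test'[rotated])
  show thesis
  proof (rule that[of "suminf v"])
    fix \<phi> :: "'a \<Rightarrow> real" assume \<phi>: "bounded_linear \<phi>"
    let ?f = "\<lambda>s. ramp s * \<phi> (T s x)"
    have fc: "continuous_on {0..} ?f"
      by (intro continuous_intros orbit_continuous[OF \<phi>])
    have "(\<lambda>n. \<Sum>k<n. v k) \<longlonglongrightarrow> suminf v" by (rule summable_LIMSEQ[OF sv])
    then have 1: "(\<lambda>n. \<phi> (\<Sum>k<n. v k)) \<longlonglongrightarrow> \<phi> (suminf v)" by (rule bounded_linear.tendsto[OF \<phi>])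
    have vk: "\<phi> (v k) = primitive ?f (real (Suc k)) - primitive ?f (real k)" for k
    proof -
      have "F integrable_on {real k..real (Suc k)}"
        by (rule integrable_continuous_interval, rule continuous_on_subset[OF Fc]) auto
      from integral_linear[OF this \<phi>]
      have "\<phi> (v k) = integral {real k..real (Suc k)} ?f"
        using linear_scale[OF bounded_linear.linear[OF \<phi>]] by (simp add: v_def F_def comp_def)
      also have "\<dots> = primitive ?f (real (Suc k)) - primitive ?f (real k)"
        by (rule primitive_diff[OF fc, symmetric]) auto
      finally show ?thesis .
    qed
    have 2: "\<phi> (\<Sum>k<n. v k) = primitive ?f (real n)" for n
    proof -
      have "\<phi> (\<Sum>k<n. v k) = (\<Sum>k<n. primitive ?f (real (Suc k)) - primitive ?f (real k))"
        unfolding linear_sum[OF bounded_linear.linear[OF \<phi>]] vk ..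
      also have "\<dots> = primitive ?f (real n)"
        by (subst sum_lessThan_telescope) (simp add: primitive_def)
      finally show ?thesis .
    qed
    obtain C where C: "C \<ge> 0" "\<And>u. u \<ge> 0 \<Longrightarrow> \<bar>\<phi> (T u x)\<bar> \<le> C"
      using orbit_bounded_cont[OF \<phi>] bounded_contE by metis
    have fi: "set_integrable lborel {0..} ?f"
      unfolding set_integrable_def
    proof (rule Bochner_Integration.integrable_bound)
      show "integrable lborel (\<lambda>u. C * ramp u)" using ramp_integrable by simp
      show "(\<lambda>u. indicator {0..} u *\<^sub>R ?f u) \<in> borel_measurable lborel"
        using borel_measurable_continuous_on_indicator[OF _ fc] by simp
      show "AE u in lborel. norm (indicator {0..} u *\<^sub>R ?f u) \<le> norm (C * ramp u)"
      proof (rule AE_I2)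
        fix u
        show "norm (indicator {0..} u *\<^sub>R ?f u) \<le> norm (C * ramp u)"
        proof (cases "u \<ge> 0")
          case True
          then show ?thesis
            using mult_right_mono[OF C(2)[OF True] ramp_nonneg[of u]] ramp_nonneg[of u] C(1)
            by (simp add: abs_mult mult.commute)
        qed simp
      qed
    qed
    have 3: "primitive ?f t = (LINT u:{0..t}|lborel. ?f u)" for t
      unfolding primitive_def
      by (rule set_borel_integral_eq_integral(2)[symmetric], rule set_integrable_subset[OF fi]) auto
    have "((\<lambda>t. LINT u:{0..t}|lborel. ?f u) \<longlongrightarrow> (LINT u:{0..}|lborel. ?f u)) at_top"
      by (rule tendsto_set_lebesgue_integral_at_top[OF _ fi]) auto
    then have "(\<lambda>n. primitive ?f (real n)) \<longlonglongrightarrow> (LINT u:{0..}|lborel. ?f u)"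
      unfolding 3 by (rule filterlim_compose[OF _ filterlim_real_sequentially])
    with 1 show "\<phi> (suminf v) = (LINT s:{0..}|lborel. ?f s)"
      unfolding 2 by (rule LIMSEQ_unique)
  qed
qed

lemma orbit_functional_bound:
  fixes \<phi> :: "'a \<Rightarrow> real"
  assumes M: "\<And>s x. s \<ge> 0 \<Longrightarrow> norm (T s x) \<le> M * norm x"
    and \<phi>: "\<And>u. \<bar>\<phi> u\<bar> \<le> norm u" and "s \<ge> 0"
  shows "\<bar>\<phi> (T s x)\<bar> \<le> M * norm x"
  using M[OF \<open>s \<ge> 0\<close>, of x] \<phi>[of "T s x"] by linarith

section \<open>Transfer from the orbit of \<open>x\<close> to the orbit of \<open>y\<close>\<close>

context
  fixes \<mu> :: "real measure" and x y :: 'a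
  assumes mu: "radon_Rplus \<mu>" "laplace_transformable \<mu>"
    and weak: "\<And>\<phi>::'a \<Rightarrow> real. bounded_linear \<phi> \<Longrightarrow>
       ((\<lambda>\<alpha>. LINT s:{0..}|\<mu>. exp (- \<alpha> * s) * \<phi> (T s x)) \<longlongrightarrow> \<phi> y) (at_right 0)"
begin

lemma orbit_laplace:
  fixes \<phi> :: "'a \<Rightarrow> real"
  assumes \<phi>: "bounded_linear \<phi>" "\<And>u. \<bar>\<phi> u\<bar> \<le> norm u * B" and M: "\<And>s x. s \<ge> 0 \<Longrightarrow> norm (T s x) \<le> M * norm x"
    and \<alpha>: "\<alpha> > 0" and B: "B \<ge> 0"
  shows "set_integrable \<mu> {0..} (\<lambda>s. exp (- \<alpha> * s) * \<phi> (T s x))"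
    and "\<bar>LINT s:{0..}|\<mu>. exp (- \<alpha> * s) * \<phi> (T s x)\<bar> \<le> M * norm x * B * laplace \<mu> \<alpha>"
proof -
  let ?F = "\<lambda>s. exp (- \<alpha> * s) * \<phi> (T s x)"
  have c: "continuous_on {0..} ?F" by (intro continuous_intros orbit_continuous \<phi>(1))
  have le: "\<bar>?F u\<bar> \<le> (M * norm x * B) * exp (- \<alpha> * u)" if "u \<ge> 0" for u
  proof -
    have "\<bar>\<phi> (T u x)\<bar> \<le> M * norm x * B"
      using \<phi>(2)[of "T u x"] mult_right_mono[OF M[OF that, of x] B] by linarith
    then show ?thesis by (simp add: abs_mult mult.commute)
  qed
  show "set_integrable \<mu> {0..} ?F"
    using shift_integrable(1)[OF mu c le \<alpha>, of 0] by simp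
  show "\<bar>LINT s:{0..}|\<mu>. ?F s\<bar> \<le> M * norm x * B * laplace \<mu> \<alpha>"
    using shift_integrable(2)[OF mu c le \<alpha>, of 0] by (simp add: laplace_conv_def)
qed

text \<open>The bound in \<open>r\<close> and \<open>n\<close> required by \<open>normal_functional_Abel_limit\<close> comes from the
  uniform boundedness principle on the dual space.\<close>

lemma orbit_transfer:
  fixes \<phi> :: "'a \<Rightarrow> real"
  assumes \<Gamma>: "normal_functional \<Gamma>" and \<Lambda>: "normal_functional \<Lambda>"
    and eq: "\<And>z. z > 0 \<Longrightarrow> laplace \<mu> z * \<Gamma> (\<lambda>u. exp (- z * u)) = \<Lambda> (\<lambda>u. exp (- z * u))"
    and \<phi>: "bounded_linear \<phi>"
  shows "\<Lambda> (\<lambda>s. \<phi> (T s x)) = \<Gamma> (\<lambda>s. \<phi> (T s y))"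
proof -
  obtain M where M: "M \<ge> 0" "\<And>s x. s \<ge> 0 \<Longrightarrow> norm (T s x) \<le> M * norm x" using semigroup_bound by metis
  define \<alpha> where "\<alpha> n = inverse (real (Suc n))" for n
  have \<alpha>: "\<alpha> n > 0" "\<alpha> \<longlonglongrightarrow> 0" for n
    unfolding \<alpha>_def using LIMSEQ_inverse_real_of_nat by auto
  have \<alpha>r: "filterlim \<alpha> (at_right 0) sequentially"
    using \<alpha> less_imp_neq[OF \<alpha>(1), symmetric] by (simp add: filterlim_at)
  define H where "H n \<psi> = (LINT s:{0..}|\<mu>. exp (- \<alpha> n * s) * \<psi> (T s x))" for n and \<psi> :: "'a \<Rightarrow> real"
  have Hlim: "(\<lambda>n. H n \<psi>) \<longlonglongrightarrow> \<psi> y" if "bounded_linear \<psi>" for \<psi>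
    unfolding H_def by (rule filterlim_compose[OF weak[OF that] \<alpha>r])
  have lin: "bounded_linear (\<lambda>\<psi>. H n (blinfun_apply \<psi>))" for n
  proof (rule bounded_linear_intro)
    have b: "\<bar>blinfun_apply \<psi> u\<bar> \<le> norm u * norm \<psi>" for \<psi> :: "'a \<Rightarrow>\<^sub>L real" and u
      using norm_blinfun[of \<psi> u] by (simp add: mult.commute)
    have i: "set_integrable \<mu> {0..} (\<lambda>s. exp (- \<alpha> n * s) * blinfun_apply \<psi> (T s x))" for \<psi> :: "'a \<Rightarrow>\<^sub>L real"
      by (rule orbit_laplace(1)[OF blinfun.bounded_linear_right b M(2) \<alpha>(1) norm_ge_zero])
    show "H n (blinfun_apply (\<psi> + \<eta>)) = H n (blinfun_apply \<psi>) + H n (blinfun_apply \<eta>)"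
      for \<psi> \<eta> :: "'a \<Rightarrow>\<^sub>L real"
      unfolding H_def blinfun.add_left distrib_left by (rule set_integral_add(2)[OF i i])
    show "H n (blinfun_apply (c *\<^sub>R \<psi>)) = c *\<^sub>R H n (blinfun_apply \<psi>)" for c and \<psi> :: "'a \<Rightarrow>\<^sub>L real"
      unfolding H_def blinfun.scaleR_left by (simp add: mult.left_commute)
    show "norm (H n (blinfun_apply \<psi>)) \<le> norm \<psi> * (M * norm x * laplace \<mu> (\<alpha> n))" for \<psi> :: "'a \<Rightarrow>\<^sub>L real"
      using orbit_laplace(2)[OF blinfun.bounded_linear_right b M(2) \<alpha>(1)[of n] norm_ge_zero, of \<psi>]
      by (simp add: H_def ac_simps)
  qed
  have pt: "\<exists>C. \<forall>n. \<bar>H n (blinfun_apply \<psi>)\<bar> \<le> C" for \<psi> :: "'a \<Rightarrow>\<^sub>L real"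
    using convergent_imp_Bseq[OF convergentI[OF Hlim[OF blinfun.bounded_linear_right[of \<psi>]]]]
    by (auto simp: Bseq_def)
  obtain K where K: "\<And>n (\<psi>::'a \<Rightarrow>\<^sub>L real). \<bar>H n (blinfun_apply \<psi>)\<bar> \<le> K * norm \<psi>"
    using uniform_boundedness[OF lin pt] by blast
  \<comment> \<open>Over a trivial dual space \<open>K\<close> could be negative; the absolute value
    allows multiplication of inequalities.\<close>
  have K0: "\<bar>H n (blinfun_apply \<psi>)\<bar> \<le> \<bar>K\<bar> * norm \<psi>" for n and \<psi> :: "'a \<Rightarrow>\<^sub>L real"
    using K[of n \<psi>] mult_right_mono[OF abs_ge_self norm_ge_zero, of K \<psi>] by linarith
  \<comment> \<open>By the semigroup law, translating the orbit by \<open>r\<close> amounts to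
    composing \<phi> with \<open>T r\<close>. The norm of this functional is at most
    \<open>M * B\<close> for every \<open>r\<close>, so one constant \<open>K\<close> serves all
    translates.\<close>
  have shift: "(LINT s:{0..}|\<mu>. exp (- \<alpha> n * s) * \<phi> (T (s + r) x)) = H n (\<lambda>u. \<phi> (T r u))" if "r \<ge> 0" for n r
    unfolding H_def using that semigroup_add[OF that] sets_mu[OF mu]
    by (intro set_lebesgue_integral_cong) (auto simp: add.commute)
  obtain B where B: "B \<ge> 0" "\<And>u. norm (\<phi> u) \<le> norm u * B" using bounded_linear.nonneg_bounded[OF \<phi>] by metis
  show ?thesis
  proof (rule normal_functional_Abel_limit[OF mu \<Gamma> \<Lambda> eq orbit_bounded_cont[OF \<phi>] orbit_continuous[OF \<phi>] \<alpha>])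
    show "\<bar>LINT s:{0..}|\<mu>. exp (- \<alpha> n * s) * \<phi> (T (s + r) x)\<bar> \<le> \<bar>K\<bar> * (M * B)" if r: "r \<ge> 0" for n r
    proof -
      have ap: "blinfun_apply (Blinfun (\<lambda>u. \<phi> (T r u))) = (\<lambda>u. \<phi> (T r u))"
        by (rule bounded_linear_Blinfun_apply[OF functional_semigroup[OF \<phi> r]])
      have "norm (Blinfun (\<lambda>u. \<phi> (T r u))) \<le> M * B"
      proof (rule norm_blinfun_bound)
        show "0 \<le> M * B" using M(1) B(1) by simp
        show "norm (blinfun_apply (Blinfun (\<lambda>u. \<phi> (T r u))) u) \<le> M * B * norm u" for u
          using B(2)[of "T r u"] mult_right_mono[OF M(2)[OF r, of u] B(1)] by (simp add: ap ac_simps)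
      qed
      from mult_left_mono[OF this, of "\<bar>K\<bar>"] show ?thesis
        using K0[of n "Blinfun (\<lambda>u. \<phi> (T r u))"] unfolding shift[OF r] ap by linarith
    qed
    show "(\<lambda>n. LINT s:{0..}|\<mu>. exp (- \<alpha> n * s) * \<phi> (T (s + r) x)) \<longlonglongrightarrow> \<phi> (T r y)" if r: "r \<ge> 0" for r
      unfolding shift[OF r] by (rule Hlim[OF functional_semigroup[OF \<phi> r]])
  qed auto
qed

end

end

section \<open>The regularised identity and the decay of Cesaro means\<close>

locale potential_orbit = bernstein_triple b \<nu> g
  for b :: real and \<nu> :: "real measure" and g :: "real \<Rightarrow> real" +
  fixes \<mu> :: "real measure" and T :: "real \<Rightarrow> 'a::banach \<Rightarrow> 'a" and x y :: 'a
  assumes mu: "radon_Rplus \<mu>" "laplace_transformable \<mu>"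
    and T: "bounded_C0_semigroup T"
    and weak: "\<And>\<phi>::'a \<Rightarrow> real. bounded_linear \<phi> \<Longrightarrow>
       ((\<lambda>\<alpha>. LINT s:{0..}|\<mu>. exp (- \<alpha> * s) * \<phi> (T s x)) \<longlongrightarrow> \<phi> y) (at_right 0)"
    and inv: "\<And>z. z > 0 \<Longrightarrow> laplace \<mu> z * g z = 1"
begin

lemma g_inverse: "z > 0 \<Longrightarrow> g z = 1 / laplace \<mu> z"
  using inv[of z] by (metis mult_zero_left nonzero_eq_divide_eq mult.commute zero_neq_one)

lemma g_nonneg: "z > 0 \<Longrightarrow> g z \<ge> 0"
  unfolding g_inverse laplace_def set_lebesgue_integral_def
  by (intro divide_nonneg_nonneg Bochner_Integration.integral_nonneg) auto

lemma hp_apply_pos_density: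
  assumes k: "integrable lborel k"
  shows "hp_apply (pos_density k) (pos_density (\<lambda>u. - k u)) T v w
    \<longleftrightarrow> (\<forall>\<phi>::'a \<Rightarrow> real. bounded_linear \<phi> \<longrightarrow> \<phi> w = (LINT s:{0..}|lborel. k s * \<phi> (T s v)))"
  unfolding hp_apply_def using pos_density_diff[OF k orbit_bounded_cont[OF T]] by simp

lemma laplace2_pos_density:
  assumes k: "integrable lborel k" and z: "z > 0"
  shows "laplace2 (pos_density k) (pos_density (\<lambda>u. - k u)) z = (LINT u:{0..}|lborel. k u * exp (- z * u))"
  using pos_density_diff[OF k bounded_cont_exp[of z]] z
  by (simp add: laplace2_def laplace_def mult.commute)

text \<open>The witnesses are the signed measures with densities \<open>ramp\<close> and
  \<open>kernel\<close> and the vector \<open>w = e(A) x\<close>. The quotient of their Laplace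
  transforms is \<open>g\<close>, which makes the transfer between the two orbits
  applicable.\<close>

lemma regularised_identity: "hp_ext (\<lambda>z. 1 / laplace \<mu> z) T y x"
proof -
  have nk: "finite_Rplus (pos_density k)" "finite_Rplus (pos_density (\<lambda>u. - k u))"
    if "integrable lborel k" "\<And>u. u < 0 \<Longrightarrow> k u = 0" for k
    using that by (auto intro!: finite_Rplus_pos_density)
  obtain w where w: "\<And>\<phi> :: 'a \<Rightarrow> real. bounded_linear \<phi> \<Longrightarrow> \<phi> w = (LINT s:{0..}|lborel. ramp s * \<phi> (T s x))"
    using ramp_average_exists[OF T] by metis
  show ?thesis
    unfolding hp_ext_def
  proof (intro exI conjI allI impI)
    show "finite_Rplus (pos_density ramp)" "finite_Rplus (pos_density (\<lambda>u. - ramp u))"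
      by (rule nk[OF ramp_integrable]; simp add: ramp_def)+
    show "finite_Rplus (pos_density kernel)" "finite_Rplus (pos_density (\<lambda>u. - kernel u))"
      by (rule nk[OF kernel_integrable kernel_neg]; assumption)+
    show "laplace2 (pos_density kernel) (pos_density (\<lambda>u. - kernel u)) z =
        laplace2 (pos_density ramp) (pos_density (\<lambda>u. - ramp u)) z * (1 / laplace \<mu> z)" if "z > 0" for z
      using laplace2_pos_density[OF kernel_integrable that] laplace2_pos_density[OF ramp_integrable that]
        kernel_laplace[OF that] ramp_laplace[OF that] g_inverse[OF that] by simp
    show "hp_apply (pos_density ramp) (pos_density (\<lambda>u. - ramp u)) T x w"
      using w by (simp add: hp_apply_pos_density[OF ramp_integrable])
    show "hp_apply (pos_density kernel) (pos_density (\<lambda>u. - kernel u)) T y w"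
      unfolding hp_apply_pos_density[OF kernel_integrable]
    proof (intro allI impI)
      fix \<phi> :: "'a \<Rightarrow> real" assume \<phi>: "bounded_linear \<phi>"
      have "(LINT s:{0..}|lborel. ramp s * \<phi> (T s x)) = (LINT s:{0..}|lborel. kernel s * \<phi> (T s y))"
      proof (rule orbit_transfer[OF T mu weak normal_functional_kernel[OF kernel_integrable]
            normal_functional_kernel[OF ramp_integrable] _ \<phi>])
        show "laplace \<mu> z * (LINT u:{0..}|lborel. kernel u * exp (- z * u))
            = (LINT u:{0..}|lborel. ramp u * exp (- z * u))" if "z > 0" for z
          unfolding kernel_laplace[OF that] ramp_laplace[OF that] using inv[OF that]
          by (simp add: mult.assoc[symmetric])
      qed
      then show "\<phi> w = (LINT s:{0..}|lborel. kernel s * \<phi> (T s y))" using w[OF \<phi>] by simp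
    qed
    show "u = 0" if "hp_apply (pos_density ramp) (pos_density (\<lambda>u. - ramp u)) T u 0" for u
    proof -
      have z: "(LINT s:{0..}|lborel. ramp s * \<phi> (T s u)) = 0" if "bounded_linear \<phi>" for \<phi> :: "'a \<Rightarrow> real"
        using \<open>hp_apply _ _ T u 0\<close> that linear_0[OF bounded_linear.linear[OF that]]
        by (simp add: hp_apply_pos_density[OF ramp_integrable])
      obtain \<phi> :: "'a \<Rightarrow> real" where \<phi>: "bounded_linear \<phi>" "\<phi> u = norm u"
        using Hahn_Banach_norming by metis
      \<comment> \<open>Testing \<open>e(A) u = 0\<close> with \<phi> composed with
        \<open>T r\<close> makes the averages of all translates of one orbit vanish; since \<phi> is
        norming at \<open>u\<close>, the value of the orbit at \<open>0\<close> is
        \<open>norm u\<close>.\<close>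
      have "\<phi> (T 0 u) = 0"
      proof (rule ramp_average_injective[OF orbit_bounded_cont[OF T \<phi>(1)]])
        fix r :: real assume r: "r \<ge> 0"
        have "(LINT s:{0..}|lborel. ramp s * \<phi> (T (s + r) u)) = (LINT s:{0..}|lborel. ramp s * \<phi> (T r (T s u)))"
          using semigroup_add[OF T r] by (intro set_lebesgue_integral_cong) (auto simp: add.commute)
        then show "(LINT s:{0..}|lborel. ramp s * \<phi> (T (s + r) u)) = 0"
          using z[OF functional_semigroup[OF T \<phi>(1) r]] by simp
      qed
      then show ?thesis using \<phi>(2) by (simp add: semigroup_zero[OF T])
    qed
  qed
qed

text \<open>Both decay statements for \<open>x\<close> are thereby reduced to estimates of
  \<open>level t\<close> on the orbit of \<open>y\<close>.\<close>

lemma primitive_orbit: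
  fixes \<phi> :: "'a \<Rightarrow> real"
  assumes \<phi>: "bounded_linear \<phi>" and t: "t \<ge> 0"
  shows "primitive (\<lambda>s. \<phi> (T s x)) t = level t (\<lambda>s. \<phi> (T s y))"
proof (rule orbit_transfer[OF T mu weak normal_functional_level[OF t] normal_functional_primitive _ \<phi>])
  show "laplace \<mu> z * level t (\<lambda>u. exp (- z * u)) = primitive (\<lambda>u. exp (- z * u)) t" if "z > 0" for z
    unfolding level_exp[OF that t] using inv[OF that] by (simp add: mult.assoc[symmetric])
qed

lemma norm_cesaro_le:
  assumes t: "t > 0" and le: "\<And>\<phi>::'a \<Rightarrow> real. bounded_linear \<phi> \<Longrightarrow> (\<And>u. \<bar>\<phi> u\<bar> \<le> norm u) \<Longrightarrow>
      \<bar>level t (\<lambda>s. \<phi> (T s y))\<bar> \<le> C * (t * g (1 / t))"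
  shows "norm (cesaro T t x) \<le> C * g (1 / t)"
proof -
  obtain \<phi> :: "'a \<Rightarrow> real" where \<phi>: "bounded_linear \<phi>" "\<And>u. \<bar>\<phi> u\<bar> \<le> norm u" "\<phi> (cesaro T t x) = norm (cesaro T t x)"
    using Hahn_Banach_norming by metis
  have "norm (cesaro T t x) = (1 / t) * level t (\<lambda>s. \<phi> (T s y))"
    using functional_cesaro[OF T \<phi>(1), of t x] primitive_orbit[OF \<phi>(1), of t] t \<phi>(3) by simp
  also have "\<dots> \<le> (1 / t) * (C * (t * g (1 / t)))"
    using le[OF \<phi>(1,2)] t by (intro mult_left_mono) auto
  finally show ?thesis using t by simp
qed

lemma level_orbit_bound:
  fixes \<phi> :: "'a \<Rightarrow> real"
  assumes M: "\<And>s x. s \<ge> 0 \<Longrightarrow> norm (T s x) \<le> M * norm x"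
    and \<phi>: "bounded_linear \<phi>" "\<And>u. \<bar>\<phi> u\<bar> \<le> norm u" and t: "t > 0"
  shows "\<bar>level t (\<lambda>s. \<phi> (T s v))\<bar> \<le> 4 * (M * norm v) * (t * g (1 / t))"
  by (rule level_bound[OF orbit_continuous[OF T \<phi>(1)] orbit_functional_bound[OF T M \<phi>(2)] t])

lemma cesaro_bigo: "(\<lambda>t. norm (cesaro T t x)) \<in> O[at_top](\<lambda>t. 1 / laplace \<mu> (1 / t))"
proof -
  obtain M where M: "M \<ge> 0" "\<And>s x. s \<ge> 0 \<Longrightarrow> norm (T s x) \<le> M * norm x" using semigroup_bound[OF T] by metis
  have "norm (cesaro T t x) \<le> 4 * (M * norm y) * g (1 / t)" if "t > 0" for t
    using level_orbit_bound[OF M(2)] that by (intro norm_cesaro_le) auto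
  then have "norm (norm (cesaro T t x)) \<le> 4 * (M * norm y) * norm (1 / laplace \<mu> (1 / t))" if "t > 0" for t
    using that g_nonneg[of "1 / t"] by (simp add: g_inverse)
  then show ?thesis
    by (intro bigoI[of _ "4 * (M * norm y)"] eventually_mono[OF eventually_gt_at_top[of 0]])
qed

text \<open>These are the vectors on which \<open>t * g(A) * C\<^sub>t(A)\<close> is
  \<open>o(t * g (1 / t))\<close> in norm. The norm is replaced by a supremum over functionals
  bounded by the norm, which is why \<phi> is quantified after the threshold in
  \<open>t\<close>.\<close>

definition small_level :: "'a set" where
  "small_level = {v. \<forall>\<epsilon>>0. \<forall>\<^sub>F t in at_top. \<forall>\<phi>::'a \<Rightarrow> real. bounded_linear \<phi> \<longrightarrow> (\<forall>u. \<bar>\<phi> u\<bar> \<le> norm u) \<longrightarrow>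
      \<bar>level t (\<lambda>s. \<phi> (T s v))\<bar> \<le> \<epsilon> * (t * g (1 / t))}"

lemma level_orbit_lincomb:
  fixes \<phi> :: "'a \<Rightarrow> real"
  assumes \<phi>: "bounded_linear \<phi>" and t: "t \<ge> 0"
  shows "level t (\<lambda>s. \<phi> (T s (c *\<^sub>R u + d *\<^sub>R v))) = c * level t (\<lambda>s. \<phi> (T s u)) + d * level t (\<lambda>s. \<phi> (T s v))"
proof -
  have eq: "\<phi> (T s (c *\<^sub>R u + d *\<^sub>R v)) = c * \<phi> (T s u) + d * \<phi> (T s v)" if "s \<ge> 0" for s
  proof -
    interpret bounded_linear "\<lambda>u. \<phi> (T s u)" by (rule functional_semigroup[OF T \<phi> that])
    show ?thesis by (simp add: add scaleR)
  qed
  have "level t (\<lambda>s. \<phi> (T s (c *\<^sub>R u + d *\<^sub>R v))) = level t (\<lambda>s. c * \<phi> (T s u) + d * \<phi> (T s v))"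
    by (rule level_cong[OF t]) (rule eq)
  then show ?thesis
    using normal_functional_lincomb[OF normal_functional_level[OF t] orbit_bounded_cont[OF T \<phi>] orbit_bounded_cont[OF T \<phi>]]
    by simp
qed

lemma subspace_small_level: "subspace small_level"
proof (rule subspaceI)
  have nn: "0 \<le> t * g (1 / t)" if "t > 0" for t using g_nonneg[of "1 / t"] that by simp
  have comb: "c *\<^sub>R u + d *\<^sub>R v \<in> small_level" if "u \<in> small_level" "v \<in> small_level" for u v c d
    unfolding small_level_def
  proof (intro CollectI allI impI)
    fix \<epsilon> :: real assume \<epsilon>: "\<epsilon> > 0"
    define \<delta> where "\<delta> = \<epsilon> / (\<bar>c\<bar> + \<bar>d\<bar> + 1)"
    have \<delta>: "\<delta> > 0" "(\<bar>c\<bar> + \<bar>d\<bar>) * \<delta> \<le> \<epsilon>"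
      using \<epsilon> by (auto simp: \<delta>_def field_simps intro!: divide_pos_pos add_nonneg_pos)
    have "\<forall>\<^sub>F t in at_top. \<forall>\<phi>::'a \<Rightarrow> real. bounded_linear \<phi> \<longrightarrow> (\<forall>u. \<bar>\<phi> u\<bar> \<le> norm u) \<longrightarrow>
      \<bar>level t (\<lambda>s. \<phi> (T s u))\<bar> \<le> \<delta> * (t * g (1 / t))" 
      "\<forall>\<^sub>F t in at_top. \<forall>\<phi>::'a \<Rightarrow> real. bounded_linear \<phi> \<longrightarrow> (\<forall>u. \<bar>\<phi> u\<bar> \<le> norm u) \<longrightarrow>
      \<bar>level t (\<lambda>s. \<phi> (T s v))\<bar> \<le> \<delta> * (t * g (1 / t))"
      using that \<delta>(1) unfolding small_level_def by auto
    with eventually_gt_at_top[of 0]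
    show "\<forall>\<^sub>F t in at_top. \<forall>\<phi>::'a \<Rightarrow> real. bounded_linear \<phi> \<longrightarrow> (\<forall>u. \<bar>\<phi> u\<bar> \<le> norm u) \<longrightarrow>
      \<bar>level t (\<lambda>s. \<phi> (T s (c *\<^sub>R u + d *\<^sub>R v)))\<bar> \<le> \<epsilon> * (t * g (1 / t))"
    proof (eventually_elim, intro allI impI)
      fix t :: real and \<phi> :: "'a \<Rightarrow> real"
      let ?L = "\<lambda>v. level t (\<lambda>s. \<phi> (T s v))"
      assume t: "0 < t" and \<phi>: "bounded_linear \<phi>" "\<forall>u. \<bar>\<phi> u\<bar> \<le> norm u"
        and u: "\<forall>\<phi>. bounded_linear \<phi> \<longrightarrow> (\<forall>u. \<bar>\<phi> u\<bar> \<le> norm u) \<longrightarrow> \<bar>level t (\<lambda>s. \<phi> (T s u))\<bar> \<le> \<delta> * (t * g (1 / t))"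
        and v: "\<forall>\<phi>. bounded_linear \<phi> \<longrightarrow> (\<forall>u. \<bar>\<phi> u\<bar> \<le> norm u) \<longrightarrow> \<bar>level t (\<lambda>s. \<phi> (T s v))\<bar> \<le> \<delta> * (t * g (1 / t))"
      have "\<bar>?L (c *\<^sub>R u + d *\<^sub>R v)\<bar> \<le> \<bar>c\<bar> * \<bar>?L u\<bar> + \<bar>d\<bar> * \<bar>?L v\<bar>"
        using level_orbit_lincomb[OF \<phi>(1), of t c u d v] t abs_triangle_ineq[of "c * ?L u" "d * ?L v"]
        by (simp add: abs_mult)
      also have "\<dots> \<le> \<bar>c\<bar> * (\<delta> * (t * g (1 / t))) + \<bar>d\<bar> * (\<delta> * (t * g (1 / t)))"
        using u v \<phi> by (intro add_mono mult_left_mono) auto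
      also have "\<dots> = ((\<bar>c\<bar> + \<bar>d\<bar>) * \<delta>) * (t * g (1 / t))" by (simp add: algebra_simps)
      also have "\<dots> \<le> \<epsilon> * (t * g (1 / t))" by (rule mult_right_mono[OF \<delta>(2) nn[OF t]])
      finally show "\<bar>?L (c *\<^sub>R u + d *\<^sub>R v)\<bar> \<le> \<epsilon> * (t * g (1 / t))" .
    qed
  qed
  show 0: "0 \<in> small_level"
    unfolding small_level_def
  proof (intro CollectI allI impI)
    fix \<epsilon> :: real assume \<epsilon>: "\<epsilon> > 0"
    show "\<forall>\<^sub>F t in at_top. \<forall>\<phi>::'a \<Rightarrow> real. bounded_linear \<phi> \<longrightarrow> (\<forall>u. \<bar>\<phi> u\<bar> \<le> norm u) \<longrightarrow>
      \<bar>level t (\<lambda>s. \<phi> (T s 0))\<bar> \<le> \<epsilon> * (t * g (1 / t))"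
      using eventually_gt_at_top[of 0]
    proof (eventually_elim, intro allI impI)
      fix t :: real and \<phi> :: "'a \<Rightarrow> real"
      assume t: "0 < t" and \<phi>: "bounded_linear \<phi>"
      show "\<bar>level t (\<lambda>s. \<phi> (T s 0))\<bar> \<le> \<epsilon> * (t * g (1 / t))"
        using level_orbit_lincomb[OF \<phi>, of t 0 0 0 0] t \<epsilon> nn[OF t] by simp
    qed
  qed
  show "u + v \<in> small_level" if "u \<in> small_level" "v \<in> small_level" for u v
    using comb[OF that, of 1 1] by simp
  show "c *\<^sub>R u \<in> small_level" if "u \<in> small_level" for c u
    using comb[OF that that, of c 0] by simp
qed

text \<open>After division by \<open>t * g (1 / t)\<close> the maps \<open>level t\<close> are
  bounded uniformly in \<open>t\<close> by \<open>level_orbit_bound\<close>, and convergence to zero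
  under a uniform bound passes to limits of vectors.\<close>

lemma closed_small_level: "closed small_level"
  unfolding closure_subset_eq[symmetric]
proof
  fix v assume v: "v \<in> closure small_level"
  obtain M where M: "M \<ge> 0" "\<And>s x. s \<ge> 0 \<Longrightarrow> norm (T s x) \<le> M * norm x" using semigroup_bound[OF T] by metis
  show "v \<in> small_level"
    unfolding small_level_def
  proof (intro CollectI allI impI)
    fix \<epsilon> :: real assume \<epsilon>: "\<epsilon> > 0"
    \<comment> \<open>The uniform bound is \<open>4 * M\<close>, and half of \<epsilon> is reserved
      for the approximating vector; \<open>M + 1\<close> covers \<open>M = 0\<close>.\<close>
    have "\<epsilon> / (8 * (M + 1)) > 0" using \<epsilon> M(1) by simp
    then obtain u where u: "u \<in> small_level" "dist u v < \<epsilon> / (8 * (M + 1))"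
      using v closure_approachable by blast
    have "4 * (M * norm (v - u)) \<le> 4 * ((M + 1) * (\<epsilon> / (8 * (M + 1))))"
      using u(2) M(1) by (intro mult_left_mono mult_mono) (auto simp: dist_norm norm_minus_commute)
    also have "\<dots> = \<epsilon> / 2" using M(1) by (simp add: field_simps)
    finally have small: "4 * (M * norm (v - u)) \<le> \<epsilon> / 2" .
    have "\<forall>\<^sub>F t in at_top. \<forall>\<phi>::'a \<Rightarrow> real. bounded_linear \<phi> \<longrightarrow> (\<forall>u. \<bar>\<phi> u\<bar> \<le> norm u) \<longrightarrow>
      \<bar>level t (\<lambda>s. \<phi> (T s u))\<bar> \<le> \<epsilon> / 2 * (t * g (1 / t))"
      using u(1) half_gt_zero[OF \<epsilon>] unfolding small_level_def by blast
    with eventually_gt_at_top[of 0]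
    show "\<forall>\<^sub>F t in at_top. \<forall>\<phi>::'a \<Rightarrow> real. bounded_linear \<phi> \<longrightarrow> (\<forall>u. \<bar>\<phi> u\<bar> \<le> norm u) \<longrightarrow>
      \<bar>level t (\<lambda>s. \<phi> (T s v))\<bar> \<le> \<epsilon> * (t * g (1 / t))"
    proof (eventually_elim, intro allI impI)
      fix t :: real and \<phi> :: "'a \<Rightarrow> real"
      let ?L = "\<lambda>v. level t (\<lambda>s. \<phi> (T s v))"
      assume t: "0 < t" and \<phi>: "bounded_linear \<phi>" "\<forall>u. \<bar>\<phi> u\<bar> \<le> norm u"
        and u: "\<forall>\<phi>. bounded_linear \<phi> \<longrightarrow> (\<forall>u. \<bar>\<phi> u\<bar> \<le> norm u) \<longrightarrow> \<bar>level t (\<lambda>s. \<phi> (T s u))\<bar> \<le> \<epsilon> / 2 * (t * g (1 / t))"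
      have nn: "0 \<le> t * g (1 / t)" using g_nonneg[of "1 / t"] t by simp
      have "?L v = ?L u + ?L (v - u)"
        using level_orbit_lincomb[OF \<phi>(1), of t 1 u 1 "v - u"] t by simp
      moreover have "\<bar>?L (v - u)\<bar> \<le> \<epsilon> / 2 * (t * g (1 / t))"
        using level_orbit_bound[OF M(2) \<phi>(1) _ t, of "v - u"] \<phi>(2) mult_right_mono[OF small nn] by force
      moreover have "\<bar>?L u\<bar> \<le> \<epsilon> / 2 * (t * g (1 / t))" using u \<phi> by blast
      ultimately show "\<bar>?L v\<bar> \<le> \<epsilon> * (t * g (1 / t))" by (simp add: abs_if split: if_splits)
    qed
  qed
qed

text \<open>After the exchange the fixed \<open>r\<close> is the level and \<open>t\<close> only a
  translation, so the bound no longer depends on \<open>t\<close>. Divergence of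
  \<open>t * g (1 / t)\<close> makes a fixed bound negligible.\<close>

lemma difference_small_level:
  assumes lim: "filterlim (\<lambda>t. t * g (1 / t)) at_top at_top" and r: "r > 0"
  shows "w - T r w \<in> small_level"
  unfolding small_level_def
proof (intro CollectI allI impI)
  fix \<epsilon> :: real assume \<epsilon>: "\<epsilon> > 0"
  obtain M where M: "M \<ge> 0" "\<And>s x. s \<ge> 0 \<Longrightarrow> norm (T s x) \<le> M * norm x" using semigroup_bound[OF T] by metis
  \<comment> \<open>The bound of \<open>level_bound\<close> at level \<open>r\<close>, for a
    difference of two values of an orbit bounded by \<open>M * norm w\<close>; hence the additional
    factor \<open>2\<close>.\<close>
  define K where "K = 4 * (2 * (M * norm w)) * (r * g (1 / r))"
  have "\<forall>\<^sub>F t in at_top. K / \<epsilon> \<le> t * g (1 / t)" using lim by (simp add: filterlim_at_top)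
  with eventually_gt_at_top[of 0]
  show "\<forall>\<^sub>F t in at_top. \<forall>\<phi>::'a \<Rightarrow> real. bounded_linear \<phi> \<longrightarrow> (\<forall>u. \<bar>\<phi> u\<bar> \<le> norm u) \<longrightarrow>
      \<bar>level t (\<lambda>s. \<phi> (T s (w - T r w)))\<bar> \<le> \<epsilon> * (t * g (1 / t))"
  proof (eventually_elim, intro allI impI)
    fix t :: real and \<phi> :: "'a \<Rightarrow> real"
    assume t: "0 < t" and K: "K / \<epsilon> \<le> t * g (1 / t)" and \<phi>: "bounded_linear \<phi>" "\<forall>u. \<bar>\<phi> u\<bar> \<le> norm u"
    let ?W = "\<lambda>s. \<phi> (T s w)"
    have Wc: "continuous_on {0..} ?W" by (rule orbit_continuous[OF T \<phi>(1)])
    have Wb: "\<bar>?W s\<bar> \<le> M * norm w" if "s \<ge> 0" for s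
      using orbit_functional_bound[OF T M(2) _ that] \<phi>(2) by blast
    have "level t (\<lambda>s. \<phi> (T s (w - T r w))) = level t (\<lambda>s. ?W s - ?W (s + r))"
    proof (rule level_cong)
      fix s :: real assume s: "s \<ge> 0"
      interpret bounded_linear "\<lambda>u. \<phi> (T s u)" by (rule functional_semigroup[OF T \<phi>(1) s])
      show "\<phi> (T s (w - T r w)) = ?W s - ?W (s + r)"
        using r s by (simp add: diff semigroup_add[OF T])
    qed (use t in simp)
    also have "\<dots> = level r (\<lambda>s. ?W s - ?W (s + t))"
      using r t by (intro level_swap[OF Wc]) auto
    also have "\<bar>\<dots>\<bar> \<le> K"
      unfolding K_def
    proof (rule level_bound[OF _ _ r])
      show "continuous_on {0..} (\<lambda>s. ?W s - ?W (s + t))"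
        using t by (intro continuous_intros Wc continuous_on_compose2[OF Wc]) auto
      show "\<bar>?W s - ?W (s + t)\<bar> \<le> 2 * (M * norm w)" if "s \<ge> 0" for s
        using Wb[OF that] Wb[of "s + t"] that t by linarith
    qed
    also have "K \<le> \<epsilon> * (t * g (1 / t))" using K \<epsilon> by (simp add: field_simps)
    finally show "\<bar>level t (\<lambda>s. \<phi> (T s (w - T r w)))\<bar> \<le> \<epsilon> * (t * g (1 / t))" .
  qed
qed

text \<open>A functional annihilating all \<open>w - T r w\<close> is constant along orbits; constants are killed by
  \<open>level\<close>, so it annihilates \<open>x\<close> and therefore \<open>y\<close>.\<close>

lemma limit_in_small_level:
  assumes lim: "filterlim (\<lambda>t. t * g (1 / t)) at_top at_top"
  shows "y \<in> small_level"
proof (rule ccontr)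
  assume "y \<notin> small_level"
  then obtain \<phi> :: "'a \<Rightarrow> real" where \<phi>: "bounded_linear \<phi>" "\<And>v. v \<in> small_level \<Longrightarrow> \<phi> v = 0" "\<phi> y \<noteq> 0"
    using Hahn_Banach_separate_subspace[OF subspace_small_level closed_small_level] by metis
  \<comment> \<open>Differences are in the subspace only for positive times, so \<open>s = 0\<close>
    is treated by the identity \<open>T 0 w = w\<close>.\<close>
  have const: "\<phi> (T s w) = \<phi> w" if "s \<ge> 0" for s w
    using \<phi>(2)[OF difference_small_level[OF lim, of s w]] that semigroup_zero[OF T]
      linear_diff[OF bounded_linear.linear[OF \<phi>(1)], of w "T s w"] by (cases "s = 0") auto
  \<comment> \<open>The time \<open>1\<close> is a convenient choice: the integral of the constant
    orbit of \<open>x\<close> over a unit interval is \<open>\<phi> x\<close> itself.\<close>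
  have "primitive (\<lambda>s. \<phi> (T s x)) 1 = level 1 (\<lambda>s. \<phi> (T s y))"
    by (rule primitive_orbit[OF \<phi>(1)]) simp
  moreover have "primitive (\<lambda>s. \<phi> (T s x)) 1 = \<phi> x"
    unfolding primitive_def using const
    by (subst Henstock_Kurzweil_Integration.integral_cong[where g = "\<lambda>_. \<phi> x"]) auto
  moreover have "level 1 (\<lambda>s. \<phi> (T s y)) = 0"
  proof -
    have "level 1 (\<lambda>s. \<phi> (T s y)) = level 1 (\<lambda>s. \<phi> y)" by (rule level_cong) (auto simp: const)
    also have "\<dots> = (LINT s:{0<..}|\<nu>. primitive (\<lambda>s. \<phi> y) s + primitive (\<lambda>s. \<phi> y) 1 - primitive (\<lambda>s. \<phi> y) (s + 1))"
      unfolding level_def by simp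
    also have "\<dots> = (LINT s:{0<..}|\<nu>. 0)"
    proof (rule set_lebesgue_integral_cong)
      have "primitive (\<lambda>s. \<phi> y) v = v * \<phi> y" if "v \<ge> 0" for v
        using that by (simp add: primitive_def)
      then show "\<forall>s. s \<in> {0<..} \<longrightarrow> primitive (\<lambda>s. \<phi> y) s + primitive (\<lambda>s. \<phi> y) 1 - primitive (\<lambda>s. \<phi> y) (s + 1) = 0"
        by (simp add: distrib_right)
    qed (simp add: sets_nu)
    finally show ?thesis by simp
  qed
  ultimately have "\<phi> x = 0" by simp
  then have "(LINT s:{0..}|\<mu>. exp (- \<alpha> * s) * \<phi> (T s x)) = (LINT s:{0..}|\<mu>. 0)" for \<alpha>
    using sets_mu[OF mu] by (intro set_lebesgue_integral_cong) (auto simp: const)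
  then have "((\<lambda>\<alpha>::real. 0) \<longlongrightarrow> \<phi> y) (at_right 0)"
    using weak[OF \<phi>(1)] by simp
  then have "\<phi> y = 0"
    by (rule tendsto_unique[OF trivial_limit_at_right_real _ tendsto_const])
  with \<phi>(3) show False by simp
qed

lemma cesaro_smallo:
  assumes lim: "filterlim (\<lambda>t. t / laplace \<mu> (1 / t)) at_top at_top"
  shows "(\<lambda>t. norm (cesaro T t x)) \<in> o[at_top](\<lambda>t. 1 / laplace \<mu> (1 / t))"
proof (rule landau_o.smallI)
  have "filterlim (\<lambda>t. t * g (1 / t)) at_top at_top"
    by (rule filterlim_cong[THEN iffD1, OF refl refl _ lim])
      (use eventually_gt_at_top[of 0] in eventually_elim, simp add: g_inverse)
  then have y: "y \<in> small_level" by (rule limit_in_small_level)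
  fix c :: real assume c: "c > 0"
  then have "\<forall>\<^sub>F t in at_top. \<forall>\<phi>::'a \<Rightarrow> real. bounded_linear \<phi> \<longrightarrow> (\<forall>u. \<bar>\<phi> u\<bar> \<le> norm u) \<longrightarrow>
      \<bar>level t (\<lambda>s. \<phi> (T s y))\<bar> \<le> c * (t * g (1 / t))"
    using y unfolding small_level_def by blast
  with eventually_gt_at_top[of 0]
  show "\<forall>\<^sub>F t in at_top. norm (norm (cesaro T t x)) \<le> c * norm (1 / laplace \<mu> (1 / t))"
  proof eventually_elim
    case (elim t)
    have "norm (cesaro T t x) \<le> c * g (1 / t)"
      by (rule norm_cesaro_le) (use elim in auto)
    then show ?case using elim(1) g_nonneg[of "1 / t"] by (simp add: g_inverse)
  qed
qed

end

section \<open>From the potential to a Bernstein function without constant term\<close>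

lemma bernstein_tripleI:
  assumes g: "bernstein g" and inv: "\<And>z. z > 0 \<Longrightarrow> f z = 1 / g z"
    and f0: "filterlim f at_top (at_right (0::real))"
  obtains b \<nu> where "bernstein_triple b \<nu> g"
proof -
  from g obtain a b \<nu> where *: "a \<ge> 0" "b \<ge> 0" "sets \<nu> = sets borel" "emeasure \<nu> {..0} = 0"
    "\<forall>K. compact K \<longrightarrow> K \<subseteq> {0<..} \<longrightarrow> emeasure \<nu> K < \<infinity>"
    "set_integrable \<nu> {0<..} (\<lambda>s. s / (1 + s))"
    "\<forall>z>0. g z = a + b * z + (LINT s:{0<..}|\<nu>. 1 - exp (- s * z))"
    unfolding bernstein_def by blast
  have ge: "g z \<ge> a" if "z > 0" for z
  proof -
    have "0 \<le> (LINT s:{0<..}|\<nu>. 1 - exp (- s * z))"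
      unfolding set_lebesgue_integral_def
      using that by (intro Bochner_Integration.integral_nonneg) (auto simp: indicator_def)
    then show ?thesis using * that by simp
  qed
  \<comment> \<open>A positive constant term would bound \<open>f\<close> by \<open>1 / a\<close> on
    the whole half-line.\<close>
  have "a = 0"
  proof (rule ccontr)
    assume "a \<noteq> 0"
    with *(1) have a: "a > 0" by simp
    have "eventually (\<lambda>z. f z > 1 / a) (at_right 0)"
      using f0 by (simp add: filterlim_at_top_dense)
    moreover have "eventually (\<lambda>z. z > (0::real)) (at_right 0)" by (rule eventually_at_right_less)
    ultimately have "eventually (\<lambda>z::real. False) (at_right 0)"
    proof eventually_elim
      case (elim z)
      have "1 / g z \<le> 1 / a" using ge[OF elim(2)] a by (intro divide_left_mono) auto
      then show ?case using elim inv by simp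
    qed
    then show False by simp
  qed
  then have "bernstein_triple b \<nu> g"
    using * by unfold_locales auto
  then show thesis by (rule that)
qed

text \<open>With \<open>1 / 0 = 0\<close>, the relation \<open>f z = 1 / g z\<close> alone does not
  exclude zeros of \<open>f\<close> or \<open>g\<close>; this lemma is what yields
  \<open>f z * g z = 1\<close>.\<close>

lemma laplace_nonzero:
  assumes mu: "radon_Rplus \<mu>" "laplace_transformable \<mu>"
    and f0: "filterlim (laplace \<mu>) at_top (at_right 0)" and z: "z > 0"
  shows "laplace \<mu> z \<noteq> 0"
proof
  assume 0: "laplace \<mu> z = 0"
  have "integrable \<mu> (\<lambda>s. indicator {0..} s *\<^sub>R exp (- s * z))"
    using mu z by (simp add: laplace_transformable_def set_integrable_def)
  moreover have "(LINT s|\<mu>. indicator {0..} s *\<^sub>R exp (- s * z)) = 0"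
    using 0 by (simp add: laplace_def set_lebesgue_integral_def)
  ultimately have "AE s in \<mu>. indicator {0..} s *\<^sub>R exp (- s * z) = 0"
    by (subst (asm) integral_nonneg_eq_0_iff_AE) auto
  \<comment> \<open>The exponential never vanishes, so a single zero of the transform makes the
    half-line a null set and the transform zero everywhere, contradicting its divergence at
    \<open>0\<close>.\<close>
  then have ae: "AE s in \<mu>. indicator {0..} s *\<^sub>R exp (- s * w) = 0" for w :: real
    by eventually_elim auto
  have "laplace \<mu> w = 0" for w
    unfolding laplace_def set_lebesgue_integral_def by (rule integral_eq_zero_AE[OF ae])
  moreover have "eventually (\<lambda>z. laplace \<mu> z > 0) (at_right 0)"
    using f0 by (simp add: filterlim_at_top_dense)
  ultimately show False by simp
qed

theorem theorem4p4:
  fixes \<mu> :: "real measure" and T :: "real \<Rightarrow> 'a::banach \<Rightarrow> 'a" and x y :: 'a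
  assumes mu: "radon_Rplus \<mu>" "laplace_transformable \<mu>"
    and pot: "potential (laplace \<mu>)"
    and f0: "filterlim (laplace \<mu>) at_top (at_right 0)"
    and T: "bounded_C0_semigroup T"
    and weak: "\<And>\<phi>::'a \<Rightarrow> real. bounded_linear \<phi> \<Longrightarrow>
       ((\<lambda>\<alpha>. LINT s:{0..}|\<mu>. exp (- \<alpha> * s) * \<phi> (T s x)) \<longlongrightarrow> \<phi> y) (at_right 0)"
  shows "hp_ext (\<lambda>z. 1 / laplace \<mu> z) T y x
         \<and> (\<lambda>t. norm (cesaro T t x)) \<in> O[at_top](\<lambda>t. 1 / laplace \<mu> (1 / t))
         \<and> (filterlim (\<lambda>t. t / laplace \<mu> (1 / t)) at_top at_top \<longrightarrow>
              (\<lambda>t. norm (cesaro T t x)) \<in> o[at_top](\<lambda>t. 1 / laplace \<mu> (1 / t)))"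
proof -
  obtain g where bg: "bernstein g" "\<And>z. z > 0 \<Longrightarrow> laplace \<mu> z = 1 / g z"
    using pot by (auto simp: potential_def)
  obtain b \<nu> where "bernstein_triple b \<nu> g" using bernstein_tripleI[OF bg f0] .
  then interpret bernstein_triple b \<nu> g .
  have "laplace \<mu> z * g z = 1" if "z > 0" for z
    using laplace_nonzero[OF mu f0 that] bg(2)[OF that] by auto
  then interpret potential_orbit b \<nu> g \<mu> T x y
    by unfold_locales (use mu T weak in auto)
  show ?thesis using regularised_identity cesaro_bigo cesaro_smallo by blast
qed

end
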